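(* Let $\Gamma$ be a finite abelian group (written additively) and let $S\subseteq\Gamma$ with $0\notin S$. The mixed Cayley graph $Cay(\Gamma,S)$ is integral if and only if $S\setminus\overline{S}\in\mathbb{B}(\Gamma)$ and $\overline{S}\in\mathbb{D}(\Gamma)$.
   Context: For $S\subseteq\Gamma$ with $0\notin S$, put $\overline{S}=\{u\in S: -u\notin S\}$. A subset $T\subseteq\Gamma$ is skew-symmetric if $-a\notin T$ for all $a\in T$. The mixed Cayley graph $Cay(\Gamma,S)$ has vertex set $\Gamma$ and edge set $E=\{(a,b)\in\Gamma\times\Gamma: b-a\in S\}$. Its Hermitian adjacency matrix $H=(h_{uv})_{u,v\in\Gamma}$ has $h_{uv}=1$ if $(u,v)\in E$ and $(v,u)\in E$; $h_{uv}=i$ if $(u,v)\in E$ and $(v,u)\notin E$; $h_{uv}=-i$ if $(u,v)\notin E$ and $(v,u)\in E$; and $h_{uv}=0$ otherwise, where $i=\sqrt{-1}$. A mixed graph is integral if all eigenvalues of its Hermitian adjacency matrix are integers. $\mathbb{B}(\Gamma)$ is the Boolean algebra of subsets of $\Gamma$ generated by all subgroups of $\Gamma$, i.e. all sets obtained from subgroups by finite intersections, unions and complements. For $x\in\Gamma$ and an integer $k$, $x^k$ denotes the $k$-fold sum $kx$; $ord(x)$ is the order of $x$. $\Gamma(4)=\{x\in\Gamma: ord(x)\equiv 0 \pmod 4\}$. For $m\equiv 0\pmod 4$, $G_m^1(1)=\{k\in\mathbb{Z}: k\equiv 1 \pmod 4,\ \gcd(k,m)=1\}$. The equivalence relation $\approx$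 on $\Gamma(4)$ is: $x\approx y$ if and only if $y=x^k$ for some $k\in G_m^1(1)$, where $m=ord(x)$. $\llbracket x\rrbracket$ is the $\approx$-class of $x\in\Gamma(4)$. $exp(\Gamma)$ is the exponent of $\Gamma$. If $exp(\Gamma)\equiv 0\pmod 4$, $\mathbb{D}(\Gamma)$ is the set of all skew-symmetric subsets of $\Gamma$ of the form $\llbracket x_1\rrbracket\cup\dots\cup\llbracket x_k\rrbracket$ with $x_1,\dots,x_k\in\Gamma(4)$ (the empty union $k=0$ being allowed, so $\emptyset\in\mathbb{D}(\Gamma)$). If $exp(\Gamma)\not\equiv 0\pmod 4$, $\mathbb{D}(\Gamma)=\{\emptyset\}$. *)

theory Defs
  imports Complex_Main "HOL-Algebra.Multiplicative_Group"
begin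

text \<open>
  The abelian group is a \<open>comm_group\<close> structure \<open>G\<close>, so the additive notation of
  the mathematics becomes multiplicative: \<open>0\<close> is \<open>\<one>\<close>, \<open>-a\<close> is \<open>inv a\<close>,
  \<open>b - a\<close> is \<open>b \<otimes> inv a\<close>, and the \<open>k\<close>-fold sum \<open>x\<^sup>k\<close> is \<open>x [^] k\<close>.
  A mixed graph is a pair of a vertex set \<open>V\<close> and an edge set \<open>E \<subseteq> V \<times> V\<close>.
\<close>

definition hermitian_adj :: "('v \<times> 'v) set \<Rightarrow> 'v \<Rightarrow> 'v \<Rightarrow> complex" where
  "hermitian_adj E u v =
     (if (u, v) \<in> E \<and> (v, u) \<in> E then 1
      else if (u, v) \<in> E \<and> (v, u) \<notin> E then \<i>
      else if (u, v) \<notin> E \<and> (v, u) \<in> E then - \<i>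
      else 0)"

text \<open>
  Eigenvalues of a square matrix whose rows and columns are indexed by a finite set \<open>V\<close>.
  Only the values of the matrix and of the eigenvector \<open>x\<close> on \<open>V\<close> matter; in particular
  \<open>x\<close> has to be nonzero on \<open>V\<close>.
\<close>

definition eigenvalue_on :: "'v set \<Rightarrow> ('v \<Rightarrow> 'v \<Rightarrow> complex) \<Rightarrow> complex \<Rightarrow> bool" where
  "eigenvalue_on V M \<mu> \<longleftrightarrow>
     (\<exists>x. (\<exists>v\<in>V. x v \<noteq> 0) \<and> (\<forall>u\<in>V. (\<Sum>v\<in>V. M u v * x v) = \<mu> * x u))"

definition integral_mixed_graph :: "'v set \<times> ('v \<times> 'v) set \<Rightarrow> bool" where
  "integral_mixed_graph X \<longleftrightarrow>
     (\<forall>\<mu>. eigenvalue_on (fst X) (hermitian_adj (snd X)) \<mu> \<longrightarrow> \<mu> \<in> \<int>)"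

definition Cay :: "('a, 'b) monoid_scheme \<Rightarrow> 'a set \<Rightarrow> 'a set \<times> ('a \<times> 'a) set" where
  "Cay G S = (carrier G,
     {(a, b). a \<in> carrier G \<and> b \<in> carrier G \<and> b \<otimes>\<^bsub>G\<^esub> inv\<^bsub>G\<^esub> a \<in> S})"

definition antisym_part :: "('a, 'b) monoid_scheme \<Rightarrow> 'a set \<Rightarrow> 'a set" where
  "antisym_part G S = {u \<in> S. inv\<^bsub>G\<^esub> u \<notin> S}"

definition skew_symmetric :: "('a, 'b) monoid_scheme \<Rightarrow> 'a set \<Rightarrow> bool" where
  "skew_symmetric G T \<longleftrightarrow> T \<subseteq> carrier G \<and> (\<forall>a\<in>T. inv\<^bsub>G\<^esub> a \<notin> T)"

inductive_set boolean_algebra_of :: "('a, 'b) monoid_scheme \<Rightarrow> 'a set set"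
  for G :: "('a, 'b) monoid_scheme" where
  subgroup: "subgroup H G \<Longrightarrow> H \<in> boolean_algebra_of G"
| inter: "A \<in> boolean_algebra_of G \<Longrightarrow> B \<in> boolean_algebra_of G \<Longrightarrow> A \<inter> B \<in> boolean_algebra_of G"
| union: "A \<in> boolean_algebra_of G \<Longrightarrow> B \<in> boolean_algebra_of G \<Longrightarrow> A \<union> B \<in> boolean_algebra_of G"
| compl: "A \<in> boolean_algebra_of G \<Longrightarrow> carrier G - A \<in> boolean_algebra_of G"

definition group_exponent :: "('a, 'b) monoid_scheme \<Rightarrow> nat" where
  "group_exponent G = (LEAST n. 0 < n \<and> (\<forall>x\<in>carrier G. x [^]\<^bsub>G\<^esub> n = \<one>\<^bsub>G\<^esub>))"

definition Gamma4 :: "('a, 'b) monoid_scheme \<Rightarrow> 'a set" where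
  "Gamma4 G = {x \<in> carrier G. group.ord G x mod 4 = 0}"

definition G1 :: "nat \<Rightarrow> int set" where
  "G1 m = {k. k mod 4 = 1 \<and> gcd k (int m) = 1}"

definition approx_rel :: "('a, 'b) monoid_scheme \<Rightarrow> ('a \<times> 'a) set" where
  "approx_rel G = {(x, y). x \<in> Gamma4 G \<and> y \<in> Gamma4 G \<and>
     (\<exists>k \<in> G1 (group.ord G x). y = x [^]\<^bsub>G\<^esub> k)}"

definition approx_class :: "('a, 'b) monoid_scheme \<Rightarrow> 'a \<Rightarrow> 'a set" where
  "approx_class G x = approx_rel G `` {x}"

definition DD :: "('a, 'b) monoid_scheme \<Rightarrow> 'a set set" where
  "DD G =
     (if group_exponent G mod 4 = 0
      then {T. skew_symmetric G T \<and>
               (\<exists>X. finite X \<and> X \<subseteq> Gamma4 G \<and> T = (\<Union>x\<in>X. approx_class G x))}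
      else {{}})"

end

theory Submission
  imports Defs "HOL-Number_Theory.Number_Theory" "Jordan_Normal_Form.Char_Poly"
begin

text \<open>
  Let \<open>n\<close> be the order of the group and let \<open>f\<close> be its connection function: \<open>f\<close> is \<open>1\<close> on
  \<open>A = S - antisym_part G S\<close>, \<open>\<i>\<close> on \<open>T = antisym_part G S\<close>, \<open>-\<i>\<close> on the inverses of
  \<open>T\<close>, and \<open>0\<close> elsewhere. The entry of the Hermitian adjacency matrix at \<open>(u, v)\<close> is
  \<open>f (v \<otimes> inv u)\<close>, so the characters of the group diagonalise it, and its eigenvalues are the
  sums \<open>\<lambda>\<^sub>\<chi> = (\<Sum>s. f s * \<chi> s)\<close>, one for each character \<open>\<chi>\<close>
  (\<open>eigenvalue_iff_character_sum\<close>). Everything hinges on one intermediate condition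
  (\<open>integral_Cay_iff\<close>): all these sums are integers if and only if
  \<open>f (x [^] k) = f x ^ k\<close> for all \<open>x\<close> and all \<open>k\<close> coprime to \<open>2 * n\<close>. The condition says
  that every eigenvalue is fixed by the Galois group of the cyclotomic field of order \<open>4 * n\<close>. The
  action of that group appears only through \<open>p\<close>-th powers modulo a prime \<open>p\<close>, and the fact that
  carries the argument is that a rational number in the ring \<open>R\<close> generated by the roots of unity
  of order \<open>4 * n\<close> is an integer (\<open>cyclotomic_ints_rational\<close>).

  If the sums are integers, Fourier inversion writes \<open>C * f x\<close>, where \<open>C\<close> is a power of \<open>n\<close>, as
  an integral combination of values of characters at \<open>inv x\<close>. Raising this to the power of a
  prime \<open>p\<close> gives \<open>C * f x ^ p = C * f (x [^] p)\<close> modulo \<open>p * R\<close>. If \<open>p\<close> does not divide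
  \<open>2 * n\<close>, this forces equality: the squared absolute value of \<open>f x ^ p - f (x [^] p)\<close> is one of
  \<open>0\<close>, \<open>1\<close>, \<open>2\<close>, \<open>4\<close>, and only the first is divisible by \<open>p\<close>
  (\<open>frobenius_invariance\<close>). A general \<open>k\<close> is a product of such primes. Conversely, given the
  invariance, averaging \<open>\<lambda>\<^sub>\<chi>\<close> over the exponents \<open>k\<close> coprime to \<open>4 * n\<close> turns it into a sum of
  Ramanujan sums, which are integers; thus \<open>\<lambda>\<^sub>\<chi>\<close> is rational, lies in \<open>R\<close>, and is an
  integer (\<open>character_sum_Ints\<close>).

  It remains to read the condition as one on \<open>A\<close> and \<open>T\<close>. For \<open>A\<close> it says that \<open>A\<close> is a
  union of sets of generators of cyclic subgroups, and these sets are the atoms of the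
  Boolean algebra. For \<open>T\<close>, the exponents \<open>k\<close> with \<open>k mod 4 = 1\<close> make \<open>T\<close> a union of
  classes of \<open>approx_rel\<close>. Those with \<open>k mod 4 = 3\<close> map \<open>T\<close> to its inverses, which
  excludes elements whose order is not divisible by \<open>4\<close>: such an element \<open>x\<close> satisfies
  \<open>x [^] k = x\<close> for some such \<open>k\<close>.
\<close>

section \<open>Integers of cyclotomic fields\<close>

text \<open>
  Multiplication by \<open>w\<close> acts on the generators \<open>B\<close> through an integer matrix, which has the tuple of
  generators as an eigenvector for \<open>w\<close>. So \<open>w\<close> is a root of the characteristic polynomial of that
  matrix, which is monic with integer coefficients.
\<close>

lemma algebraic_int_if_stable_lattice:
  fixes w :: complex
  assumes B: "finite B" "u \<in> B" "u \<noteq> 0"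
    and stable: "\<And>b. b \<in> B \<Longrightarrow> \<exists>c. w * b = (\<Sum>b'\<in>B. of_int (c b') * b')"
  shows "algebraic_int w"
proof -
  define n where "n = card B"
  obtain e where e: "bij_betw e {0..<n} B"
    using ex_bij_betw_nat_finite[OF B(1)] by (auto simp: n_def)
  obtain c where c: "\<And>b. b \<in> B \<Longrightarrow> w * b = (\<Sum>b'\<in>B. of_int (c b b') * b')"
    using stable by metis
  define A where "A = mat n n (\<lambda>(i, j). c (e i) (e j))"
  have A: "A \<in> carrier_mat n n" by (simp add: A_def)
  define A' :: "complex mat" where "A' = map_mat of_int A"
  have A': "A' \<in> carrier_mat n n" using A by (simp add: A'_def)
  define v where "v = vec n e"
  have eB: "e i \<in> B" if "i < n" for i
    using e that by (auto simp: bij_betw_def)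
  have "v \<noteq> 0\<^sub>v n"
  proof
    assume v0: "v = 0\<^sub>v n"
    obtain i where i: "i < n" "e i = u"
      using e B(2) by (auto simp: bij_betw_def image_iff)
    have "v $ i = 0\<^sub>v n $ i" using v0 by simp
    then show False using i B(3) by (simp add: v_def)
  qed
  moreover have "A' *\<^sub>v v = w \<cdot>\<^sub>v v"
  proof (rule eq_vecI)
    fix i assume "i < dim_vec (w \<cdot>\<^sub>v v)"
    then have i: "i < n" by (simp add: v_def)
    have "(A' *\<^sub>v v) $ i = (\<Sum>j\<in>{0..<n}. of_int (c (e i) (e j)) * e j)"
      using i by (simp add: A'_def A_def v_def scalar_prod_def)
    also have "\<dots> = (\<Sum>b\<in>B. of_int (c (e i) b) * b)"
      by (rule sum.reindex_bij_betw[OF e])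
    also have "\<dots> = w * e i" using c[OF eB[OF i]] by simp
    finally show "(A' *\<^sub>v v) $ i = (w \<cdot>\<^sub>v v) $ i" using i by (simp add: v_def)
  qed (simp add: v_def A'_def A_def)
  ultimately have "eigenvalue A' w"
    using A' by (auto simp: eigenvalue_def eigenvector_def v_def intro!: exI[of _ "vec n e"])
  then have "poly (char_poly A') w = 0" using eigenvalue_root_char_poly[OF A'] by simp
  moreover have "char_poly A' = map_poly of_int (char_poly A)"
    unfolding A'_def by (rule of_int_hom.char_poly_hom[OF A])
  moreover have "lead_coeff (char_poly A) = 1" using degree_monic_char_poly[OF A] by simp
  ultimately show ?thesis by (auto simp: algebraic_int_altdef_ipoly)
qed

text \<open>
  The additive group generated by the roots of unity of order dividing \<open>N\<close>. It is a ring because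
  the roots are closed under products: the ring of integers of the cyclotomic field.
\<close>

inductive_set cyclotomic_ints :: "nat \<Rightarrow> complex set" for N :: nat where
  root: "z ^ N = 1 \<Longrightarrow> z \<in> cyclotomic_ints N"
| diff: "x \<in> cyclotomic_ints N \<Longrightarrow> y \<in> cyclotomic_ints N \<Longrightarrow> x - y \<in> cyclotomic_ints N"

lemma cyclotomic_ints_0 [simp]: "0 \<in> cyclotomic_ints N"
  using cyclotomic_ints.diff[OF cyclotomic_ints.root cyclotomic_ints.root, of 1 N 1] by simp

lemma cyclotomic_ints_1 [simp]: "1 \<in> cyclotomic_ints N"
  by (rule cyclotomic_ints.root) simp

lemma cyclotomic_ints_uminus:
  "x \<in> cyclotomic_ints N \<Longrightarrow> - x \<in> cyclotomic_ints N"
  using cyclotomic_ints.diff[of 0 N x] by simp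

lemma cyclotomic_ints_add:
  "x \<in> cyclotomic_ints N \<Longrightarrow> y \<in> cyclotomic_ints N \<Longrightarrow> x + y \<in> cyclotomic_ints N"
  using cyclotomic_ints.diff[of x N "- y"] cyclotomic_ints_uminus[of y N] by simp

lemma cyclotomic_ints_mult:
  assumes "x \<in> cyclotomic_ints N" "y \<in> cyclotomic_ints N"
  shows "x * y \<in> cyclotomic_ints N"
  using assms(1)
proof induction
  case (root z)
  show ?case using assms(2)
  proof induction
    case (root z')
    then show ?case
      using \<open>z ^ N = 1\<close> by (intro cyclotomic_ints.root) (simp add: power_mult_distrib)
  next
    case (diff x y)
    then show ?case by (simp add: right_diff_distrib cyclotomic_ints.diff)
  qed
next
  case (diff x y)
  then show ?case by (simp add: left_diff_distrib cyclotomic_ints.diff)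
qed

lemma cyclotomic_ints_sum:
  "(\<And>i. i \<in> I \<Longrightarrow> g i \<in> cyclotomic_ints N) \<Longrightarrow> (\<Sum>i\<in>I. g i) \<in> cyclotomic_ints N"
  by (induction I rule: infinite_finite_induct) (auto intro: cyclotomic_ints_add)

lemma cyclotomic_ints_power:
  "x \<in> cyclotomic_ints N \<Longrightarrow> x ^ k \<in> cyclotomic_ints N"
  by (induction k) (auto intro: cyclotomic_ints_mult)

lemma cyclotomic_ints_of_nat: "of_nat k \<in> cyclotomic_ints N"
  by (induction k) (auto intro: cyclotomic_ints_add)

lemma cyclotomic_ints_of_int: "of_int k \<in> cyclotomic_ints N"
  by (cases k rule: int_cases2)
     (auto intro: cyclotomic_ints_of_nat cyclotomic_ints_uminus)

lemma cyclotomic_ints_cnj: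
  assumes "x \<in> cyclotomic_ints N" shows "cnj x \<in> cyclotomic_ints N"
  using assms
proof induction
  case (root z)
  then have "cnj z ^ N = 1" by (metis complex_cnj_one complex_cnj_power)
  then show ?case by (rule cyclotomic_ints.root)
qed (auto intro: cyclotomic_ints.diff)

lemma finite_roots_of_unity_complex: "N > 0 \<Longrightarrow> finite {z :: complex. z ^ N = 1}"
  using finite_roots_unity[of N, where ?'a = complex] by simp

lemma cyclotomic_ints_lattice:
  assumes N: "N > 0" and "x \<in> cyclotomic_ints N"
  shows "\<exists>c. x = (\<Sum>z | z ^ N = 1. of_int (c z) * z)"
  using assms(2)
proof induction
  case (root z)
  have "(\<Sum>y | y ^ N = 1. of_int (if y = z then 1 else 0) * y) = (\<Sum>y | y ^ N = 1. if y = z then z else 0)"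
    by (rule sum.cong) auto
  also have "\<dots> = z"
    using root finite_roots_of_unity_complex[OF N] by (simp add: sum.delta)
  finally show ?case by (intro exI[of _ "\<lambda>y. if y = z then 1 else 0"]) simp
next
  case (diff x y)
  then obtain c d where "x = (\<Sum>z | z ^ N = 1. of_int (c z) * z)"
      "y = (\<Sum>z | z ^ N = 1. of_int (d z) * z)" by auto
  then have "x - y = (\<Sum>z | z ^ N = 1. of_int (c z - d z) * z)"
    by (simp add: sum_subtractf left_diff_distrib)
  then show ?case by (intro exI[of _ "\<lambda>z. c z - d z"])
qed

lemma cyclotomic_ints_rational:
  assumes N: "N > 0" and w: "w \<in> cyclotomic_ints N" "w \<in> \<rat>"
  shows "w \<in> \<int>"
proof -
  have "algebraic_int w"
  proof (rule algebraic_int_if_stable_lattice[where B = "{z. z ^ N = 1}" and u = 1])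
    show "\<exists>c. w * b = (\<Sum>z | z ^ N = 1. of_int (c z) * z)" if "b \<in> {z. z ^ N = 1}" for b
      using that w(1) by (intro cyclotomic_ints_lattice[OF N] cyclotomic_ints_mult)
        (auto intro: cyclotomic_ints.root)
  qed (use finite_roots_of_unity_complex[OF N] in auto)
  then show ?thesis using w(2) by (rule rational_algebraic_int_is_int)
qed

text \<open>
  The prime \<open>p\<close> divides the inner binomial coefficients, so taking \<open>p\<close>-th powers is additive modulo
  \<open>p\<close> times the cyclotomic integers.
\<close>

lemma freshman_dream:
  assumes p: "prime p" and xy: "x \<in> cyclotomic_ints N" "y \<in> cyclotomic_ints N"
  shows "\<exists>r\<in>cyclotomic_ints N. (x + y) ^ p = x ^ p + y ^ p + of_nat p * r"
proof -
  have p1: "p > 1" using p by (rule prime_gt_1_nat)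
  define r where
    "r = (\<Sum>k\<in>{0<..<p}. of_nat ((p choose k) div p) * x ^ k * y ^ (p - k))"
  have "(x + y) ^ p = (\<Sum>k\<le>p. of_nat (p choose k) * x ^ k * y ^ (p - k))"
    by (rule binomial_ring)
  also have "{..p} = insert 0 (insert p {0<..<p})" using p1 by auto
  also have "(\<Sum>k\<in>\<dots>. of_nat (p choose k) * x ^ k * y ^ (p - k)) =
      x ^ p + y ^ p + (\<Sum>k\<in>{0<..<p}. of_nat (p choose k) * x ^ k * y ^ (p - k))"
    using p1 by simp
  also have "(\<Sum>k\<in>{0<..<p}. of_nat (p choose k) * x ^ k * y ^ (p - k)) = of_nat p * r"
    unfolding r_def sum_distrib_left
  proof (rule sum.cong)
    fix k assume "k \<in> {0<..<p}"
    then have "p dvd (p choose k)" using p by (simp add: dvd_choose_prime)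
    then have "of_nat (p choose k) = (of_nat p * of_nat ((p choose k) div p) :: complex)"
      by (metis dvd_mult_div_cancel of_nat_mult)
    then show "of_nat (p choose k) * x ^ k * y ^ (p - k) =
        of_nat p * (of_nat ((p choose k) div p) * x ^ k * y ^ (p - k))" by simp
  qed simp
  finally have "(x + y) ^ p = x ^ p + y ^ p + of_nat p * r" .
  moreover have "r \<in> cyclotomic_ints N" unfolding r_def
    by (intro cyclotomic_ints_sum cyclotomic_ints_mult cyclotomic_ints_power
        cyclotomic_ints_of_nat xy)
  ultimately show ?thesis by blast
qed

lemma freshman_dream_sum:
  assumes p: "prime p" and g: "\<And>i. i \<in> I \<Longrightarrow> g i \<in> cyclotomic_ints N"
  shows "\<exists>r\<in>cyclotomic_ints N. (\<Sum>i\<in>I. g i) ^ p = (\<Sum>i\<in>I. g i ^ p) + of_nat p * r"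
  using g
proof (induction I rule: infinite_finite_induct)
  case (insert i I)
  obtain r where r: "r \<in> cyclotomic_ints N" "(\<Sum>i\<in>I. g i) ^ p = (\<Sum>i\<in>I. g i ^ p) + of_nat p * r"
    using insert by auto
  obtain r' where r': "r' \<in> cyclotomic_ints N"
      "(g i + (\<Sum>i\<in>I. g i)) ^ p = g i ^ p + (\<Sum>i\<in>I. g i) ^ p + of_nat p * r'"
    using freshman_dream[OF p, of "g i" N "\<Sum>i\<in>I. g i"] insert.prems
    by (auto intro: cyclotomic_ints_sum)
  have "(\<Sum>i\<in>insert i I. g i) ^ p = (\<Sum>i\<in>insert i I. g i ^ p) + of_nat p * (r + r')"
    using insert.hyps r r' by (simp add: algebra_simps)
  then show ?case using cyclotomic_ints_add[OF r(1) r'(1)] by blast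
qed (use p prime_gt_0_nat in \<open>auto intro!: bexI[of _ 0]\<close>)

lemma fermat_little_int:
  assumes "prime p" shows "\<exists>d. (c :: int) ^ p = c + int p * d"
proof -
  have "[c ^ p = c] (mod int p)"
  proof (cases "int p dvd c")
    case True
    moreover have "c dvd c ^ p" using prime_gt_0_nat[OF assms] by (simp add: dvd_power)
    ultimately show ?thesis by (simp add: cong_iff_dvd_diff dvd_diff dvd_trans[of "int p" c])
  next
    case False
    define a where "a = nat (c mod int p)"
    have p0: "p > 0" using assms prime_gt_0_nat by blast
    have ca: "[c = int a] (mod int p)" using p0 by (simp add: a_def cong_def)
    have "\<not> int p dvd int a"
      using False ca by (simp add: cong_def dvd_eq_mod_eq_0)
    then have "\<not> p dvd a" by simp
    then have "[a ^ (p - 1) = 1] (mod p)" by (rule fermat_theorem[OF assms])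
    then have "[a * a ^ (p - 1) = a * 1] (mod p)" by (rule cong_scalar_left)
    then have "[a ^ p = a] (mod p)" using p0 by (simp flip: power_Suc)
    then have a: "[int a ^ p = int a] (mod int p)" by (simp flip: cong_int_iff)
    show ?thesis
      by (rule cong_trans[OF cong_pow[OF ca] cong_trans[OF a cong_sym[OF ca]]])
  qed
  then have "int p dvd c ^ p - c" by (simp add: cong_iff_dvd_diff)
  then obtain d where "c ^ p - c = int p * d" by (elim dvdE)
  then have "c ^ p = c + int p * d" by simp
  then show ?thesis by blast
qed

text \<open>
  Grouping the exponents \<open>k \<le> N\<close> by the value \<open>d\<close> of \<open>gcd k N\<close> expresses the full geometric sum, which
  is \<open>0\<close> or \<open>N\<close>, through the Ramanujan sums of order \<open>N div d\<close>. This allows induction on \<open>N\<close>.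
\<close>

lemma ramanujan_sum_Ints:
  fixes z :: complex
  assumes "N > 0" "z ^ N = 1"
  shows "(\<Sum>k\<in>totatives N. z ^ k) \<in> \<int>"
  using assms
proof (induction N arbitrary: z rule: less_induct)
  case (less N)
  define D where "D = {d. d dvd N}"
  have fD: "finite D" "1 \<in> D" using less.prems by (auto simp: D_def)
  have "(\<Sum>k\<in>{0<..N}. z ^ k) = (\<Sum>d\<in>D. \<Sum>k | k \<in> {0<..N} \<and> gcd k N = d. z ^ k)"
    using fD by (intro sum.group[symmetric]) (auto simp: D_def)
  also have "\<dots> = (\<Sum>d\<in>D. \<Sum>k\<in>totatives (N div d). (z ^ d) ^ k)"
  proof (rule sum.cong)
    fix d assume "d \<in> D"
    then have "d dvd N" by (simp add: D_def)
    from sum.reindex_bij_betw[OF bij_betw_totatives_gcd_eq[OF this less.prems(1)], of "\<lambda>k. z ^ k"]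
    show "(\<Sum>k | k \<in> {0<..N} \<and> gcd k N = d. z ^ k) = (\<Sum>k\<in>totatives (N div d). (z ^ d) ^ k)"
      by (simp add: power_mult[symmetric] mult.commute)
  qed simp
  also have "\<dots> = (\<Sum>k\<in>totatives N. z ^ k) +
      (\<Sum>d\<in>D - {1}. \<Sum>k\<in>totatives (N div d). (z ^ d) ^ k)"
    by (subst sum.remove[OF fD]) simp
  finally have *: "(\<Sum>k\<in>totatives N. z ^ k) = (\<Sum>k\<in>{0<..N}. z ^ k) -
      (\<Sum>d\<in>D - {1}. \<Sum>k\<in>totatives (N div d). (z ^ d) ^ k)"
    by simp
  have "(\<Sum>d\<in>D - {1}. \<Sum>k\<in>totatives (N div d). (z ^ d) ^ k) \<in> \<int>"
  proof (rule Ints_sum)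
    fix d assume "d \<in> D - {1}"
    then obtain q where q: "N = d * q" "d \<noteq> 1" by (auto simp: D_def)
    then have "q > 0" "d \<noteq> 0" using less.prems(1) by auto
    then have "d > 1" using q by linarith
    then show "(\<Sum>k\<in>totatives (N div d). (z ^ d) ^ k) \<in> \<int>"
      using q less.prems less.IH[of q "z ^ d"] by (simp add: power_mult)
  qed
  moreover have "(\<Sum>k\<in>{0<..N}. z ^ k) \<in> \<int>"
  proof (cases "z = 1")
    case False
    have "{0<..N} = Suc ` {..<N}"
      by (simp add: lessThan_atLeast0 image_Suc_atLeastLessThan atLeastSucAtMost_greaterThanAtMost
          atLeastLessThanSuc_atLeastAtMost)
    then have "(\<Sum>k\<in>{0<..N}. z ^ k) = z * (\<Sum>k<N. z ^ k)"
      by (simp add: sum.reindex sum_distrib_left)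
    also have "\<dots> = 0" using False less.prems by (simp add: geometric_sum)
    finally show ?thesis by simp
  qed simp
  ultimately show ?case unfolding * by (rule Ints_diff[rotated])
qed

section \<open>Characters of a finite abelian group\<close>

context comm_group
begin

text \<open>
  Characters are taken on a subset because they are built up along a chain of subgroups. Their
  values outside the subset are arbitrary.
\<close>

definition character_on :: "'a set \<Rightarrow> ('a \<Rightarrow> complex) \<Rightarrow> bool" where
  "character_on H \<chi> \<longleftrightarrow> \<chi> \<one> = 1 \<and> (\<forall>x\<in>H. \<forall>y\<in>H. \<chi> (x \<otimes> y) = \<chi> x * \<chi> y)"

abbreviation character :: "('a \<Rightarrow> complex) \<Rightarrow> bool" where
  "character \<equiv> character_on (carrier G)"

lemma subgroup_nat_pow_closed:
  assumes "subgroup H G" "x \<in> H" shows "x [^] (k :: nat) \<in> H"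
  using assms by (induction k) (auto simp: subgroup.one_closed subgroup.m_closed)

lemma character_on_pow:
  assumes "subgroup H G" "character_on H \<chi>" "x \<in> H"
  shows "\<chi> (x [^] (k :: nat)) = \<chi> x ^ k"
proof (induction k)
  case (Suc k)
  have "x [^] k \<in> H" using assms(1,3) by (rule subgroup_nat_pow_closed)
  then show ?case using assms Suc by (simp add: character_on_def mult.commute)
qed (use assms in \<open>simp add: character_on_def\<close>)

lemma character_on_inv:
  assumes "subgroup H G" "character_on H \<chi>" "x \<in> H"
  shows "\<chi> x * \<chi> (inv x) = 1"
proof -
  have "inv x \<in> H" "x \<in> carrier G"
    using assms(1,3) by (auto simp: subgroup.m_inv_closed subgroup.mem_carrier)
  then have "\<chi> (x \<otimes> inv x) = \<chi> x * \<chi> (inv x)"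
    using assms(2,3) unfolding character_on_def by blast
  then show ?thesis using \<open>x \<in> carrier G\<close> assms(2) by (simp add: character_on_def)
qed

text \<open>
  A character of \<open>H\<close> extends to the subgroup generated by \<open>H\<close> and \<open>a\<close> by sending \<open>h \<otimes> a [^] j\<close> to
  \<open>\<chi> h * \<omega> ^ j\<close>. Two representations of the same element differ by a power of \<open>a\<close> that lies in
  \<open>H\<close>, hence by a power of \<open>a [^] m\<close>, and the condition on \<open>\<omega>\<close> says that the two values then agree.
\<close>

lemma character_on_extend:
  assumes H: "subgroup H G" and \<chi>: "character_on H \<chi>" and a: "a \<in> carrier G"
    and m: "m > 0" "a [^] (m :: nat) \<in> H" and min: "\<And>j :: nat. a [^] j \<in> H \<Longrightarrow> m dvd j"
    and \<omega>: "\<omega> ^ m = \<chi> (a [^] m)"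
  shows "\<exists>H' \<chi>'. subgroup H' G \<and> H \<subseteq> H' \<and> a \<in> H' \<and> character_on H' \<chi>' \<and>
    (\<forall>h\<in>H. \<chi>' h = \<chi> h) \<and> \<chi>' a = \<omega>"
proof -
  have HG: "h \<in> carrier G" if "h \<in> H" for h using H that by (rule subgroup.mem_carrier)
  have Hmult: "h \<otimes> h' \<in> H" if "h \<in> H" "h' \<in> H" for h h'
    using H that by (rule subgroup.m_closed)
  have Hinv: "inv h \<in> H" if "h \<in> H" for h using H that by (rule subgroup.m_inv_closed)
  have H1: "\<one> \<in> H" using H by (rule subgroup.one_closed)
  have wd: "\<chi> h * \<omega> ^ j = \<chi> h' * \<omega> ^ j'"
    if h: "h \<in> H" "h' \<in> H" and eq: "h \<otimes> a [^] j = h' \<otimes> a [^] j'" and le: "j' \<le> j"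
    for h h' and j j' :: nat
  proof -
    define d where "d = j - j'"
    have j: "j = d + j'" using le by (simp add: d_def)
    have "(h \<otimes> a [^] d) \<otimes> a [^] j' = h' \<otimes> a [^] j'"
      using eq a HG h by (simp add: j nat_pow_mult[symmetric] m_assoc)
    then have hd: "h \<otimes> a [^] d = h'" using a HG h by (simp add: right_cancel)
    then have "a [^] d = inv h \<otimes> h'" using a HG h by (simp add: inv_solve_left)
    then have "a [^] d \<in> H" using Hmult Hinv h by simp
    then have "\<chi> h' = \<chi> h * \<chi> (a [^] d)" using \<chi> h hd by (auto simp: character_on_def)
    moreover obtain q where q: "d = m * q" using min[OF \<open>a [^] d \<in> H\<close>] by (elim dvdE)
    have "\<chi> (a [^] d) = \<omega> ^ d"
      using character_on_pow[OF H \<chi> m(2), of q] a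
      by (simp add: q nat_pow_pow \<omega>[symmetric] power_mult)
    ultimately show ?thesis by (simp add: j power_add)
  qed
  define H' where "H' = {h \<otimes> a [^] j | h j :: nat. h \<in> H}"
  \<comment> \<open>The choice is harmless: by \<open>wd\<close> every representation of \<open>x\<close> gives the same value.\<close>
  define \<chi>' where "\<chi>' x = (SOME c. \<exists>h\<in>H. \<exists>j :: nat. x = h \<otimes> a [^] j \<and> c = \<chi> h * \<omega> ^ j)" for x
  have \<chi>': "\<chi>' (h \<otimes> a [^] j) = \<chi> h * \<omega> ^ j" if "h \<in> H" for h and j :: nat
    unfolding \<chi>'_def
  proof (rule some_equality)
    fix c assume "\<exists>h'\<in>H. \<exists>j'::nat. h \<otimes> a [^] j = h' \<otimes> a [^] j' \<and> c = \<chi> h' * \<omega> ^ j'"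
    then obtain h' and j' :: nat where c: "h' \<in> H" "h \<otimes> a [^] j = h' \<otimes> a [^] j'" "c = \<chi> h' * \<omega> ^ j'"
      by auto
    show "c = \<chi> h * \<omega> ^ j"
    proof (cases "j' \<le> j")
      case True
      then show ?thesis using wd[OF that c(1,2)] c(3) by simp
    next
      case False
      then show ?thesis using wd[OF c(1) that c(2)[symmetric]] c(3) by simp
    qed
  qed (use that in auto)
  have mult: "(h \<otimes> a [^] j) \<otimes> (h' \<otimes> a [^] j') = (h \<otimes> h') \<otimes> a [^] (j + j')"
    if "h \<in> H" "h' \<in> H" for h h' and j j' :: nat
    using that HG a by (simp add: nat_pow_mult[symmetric] m_ac)
  have "subgroup H' G"
  proof
    show "H' \<subseteq> carrier G" using HG a by (auto simp: H'_def)
  next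
    fix x y assume "x \<in> H'" "y \<in> H'"
    then show "x \<otimes> y \<in> H'" unfolding H'_def using mult Hmult by fastforce
  next
    show "\<one> \<in> H'" unfolding H'_def using H1 by (auto intro!: exI[of _ \<one>] exI[of _ "0 :: nat"])
  next
    fix x assume "x \<in> H'"
    then obtain h and j :: nat where x: "x = h \<otimes> a [^] j" "h \<in> H" by (auto simp: H'_def)
    \<comment> \<open>Inverses of powers of \<open>a\<close> need no negative exponents, since \<open>a [^] m\<close> lies in \<open>H\<close>.\<close>
    define k where "k = inv ((a [^] m) [^] j) \<otimes> inv h"
    have "k \<in> H" unfolding k_def
      using Hmult Hinv x(2) m(2) H by (simp add: subgroup_nat_pow_closed)
    have jm: "j \<le> m * j" using m(1) by simp
    have aj: "(a [^] m) [^] j = a [^] (m * j - j) \<otimes> a [^] j"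
      using a jm by (simp add: nat_pow_pow nat_pow_mult)
    have "inv ((a [^] m) [^] j) \<otimes> a [^] (m * j - j) = inv (a [^] j)"
      using a by (simp add: aj inv_mult_group m_assoc)
    moreover have "k \<otimes> a [^] (m * j - j) = inv h \<otimes> (inv ((a [^] m) [^] j) \<otimes> a [^] (m * j - j))"
      using x HG a by (simp add: k_def m_ac)
    ultimately have "inv x = k \<otimes> a [^] (m * j - j)"
      using x HG a by (simp add: inv_mult)
    then show "inv x \<in> H'" using \<open>k \<in> H\<close> by (auto simp: H'_def)
  qed
  moreover have "H \<subseteq> H'"
  proof
    fix h assume "h \<in> H"
    then show "h \<in> H'" unfolding H'_def using HG by (auto intro!: exI[of _ h] exI[of _ "0 :: nat"])
  qed
  moreover have "a \<in> H'"
    unfolding H'_def using H1 a by (auto intro!: exI[of _ \<one>] exI[of _ "1 :: nat"])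
  moreover have res: "\<chi>' h = \<chi> h" if "h \<in> H" for h
    using \<chi>'[OF that, of 0] HG[OF that] by simp
  moreover have "\<chi>' a = \<omega>" using \<chi>'[OF H1, of 1] a \<chi> by (simp add: character_on_def)
  moreover have "character_on H' \<chi>'"
    unfolding character_on_def
  proof (intro conjI ballI)
    show "\<chi>' \<one> = 1" using res[OF H1] \<chi> by (simp add: character_on_def)
    fix x y assume "x \<in> H'" "y \<in> H'"
    then obtain h h' and j j' :: nat where "x = h \<otimes> a [^] j" "y = h' \<otimes> a [^] j'" "h \<in> H" "h' \<in> H"
      by (auto simp: H'_def)
    then show "\<chi>' (x \<otimes> y) = \<chi>' x * \<chi>' y"
      using \<chi> by (simp add: mult \<chi>' Hmult character_on_def power_add)
  qed
  ultimately show ?thesis by blast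
qed

lemma ex_min_power_in_subgroup:
  assumes fin: "finite (carrier G)" and H: "subgroup H G" and a: "a \<in> carrier G"
  obtains m :: nat where "m > 0" "a [^] m \<in> H" "\<And>j :: nat. a [^] j \<in> H \<Longrightarrow> m dvd j"
proof -
  define P where "P m \<longleftrightarrow> m > 0 \<and> a [^] m \<in> H" for m :: nat
  have "P (ord a)"
    using a H ord_ge_1[OF fin a] by (auto simp: P_def subgroup.one_closed)
  define m where "m = (LEAST m. P m)"
  have m: "m > 0" "a [^] m \<in> H" using LeastI[of P, OF \<open>P (ord a)\<close>] by (auto simp: m_def P_def)
  have "m dvd j" if j: "a [^] j \<in> H" for j :: nat
  proof (rule ccontr)
    assume "\<not> m dvd j"
    then have pos: "j mod m > 0" by (simp add: dvd_eq_mod_eq_0)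
    have c: "(a [^] m) [^] (j div m) \<in> H" using m(2) H by (simp add: subgroup_nat_pow_closed)
    have "a [^] j = (a [^] m) [^] (j div m) \<otimes> a [^] (j mod m)"
      using a by (simp add: nat_pow_pow nat_pow_mult)
    then have "a [^] (j mod m) = inv ((a [^] m) [^] (j div m)) \<otimes> a [^] j"
      using a by (simp add: inv_solve_left)
    then have "a [^] (j mod m) \<in> H" using H c j by (simp add: subgroup.m_closed subgroup.m_inv_closed)
    then have "m \<le> j mod m" using pos unfolding m_def by (intro Least_le) (auto simp: P_def)
    then show False using mod_less_divisor[OF m(1), of j] by linarith
  qed
  then show thesis using that m by blast
qed

text \<open>
  On the subgroup generated by \<open>x\<close>, a primitive root of unity of order \<open>ord x\<close> gives a character that is
  nontrivial at \<open>x\<close>. A largest subgroup to which such a character extends must be the whole group.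
\<close>

lemma character_separates:
  assumes fin: "finite (carrier G)" and x: "x \<in> carrier G" "x \<noteq> \<one>"
  shows "\<exists>\<chi>. character \<chi> \<and> \<chi> x \<noteq> 1"
proof -
  define P where "P H \<longleftrightarrow> subgroup H G \<and> x \<in> H \<and> (\<exists>\<chi>. character_on H \<chi> \<and> \<chi> x \<noteq> 1)" for H
  have "ord x \<ge> 1" "ord x \<noteq> 1" using x ord_ge_1[OF fin] ord_eq_1 by auto
  then have ord: "ord x > 1" by simp
  define \<omega> where "\<omega> = cis (2 * pi / ord x)"
  have "\<exists>H' \<chi>'. subgroup H' G \<and> {\<one>} \<subseteq> H' \<and> x \<in> H' \<and> character_on H' \<chi>' \<and>
    (\<forall>h\<in>{\<one>}. \<chi>' h = (\<lambda>_. 1) h) \<and> \<chi>' x = \<omega>"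
    using ord x by (intro character_on_extend[where m = "ord x"])
      (auto simp: character_on_def triv_subgroup pow_eq_id \<omega>_def DeMoivre)
  then obtain H0 \<chi>0 where "subgroup H0 G" "x \<in> H0" "character_on H0 \<chi>0" "\<chi>0 x = \<omega>" by blast
  moreover have "\<omega> \<noteq> 1"
  proof
    assume "\<omega> = 1"
    then have "cos (2 * pi / ord x) = 1" by (simp add: \<omega>_def complex_eq_iff)
    then obtain k :: int where k: "2 * pi / ord x = k * (2 * pi)"
      by (auto simp: cos_one_2pi_int)
    then have "1 = real_of_int k * real (ord x)" using ord by (simp add: field_simps)
    then have "1 = k * int (ord x)" by (metis of_int_1 of_int_eq_iff of_int_mult of_int_of_nat_eq)
    then have "int (ord x) dvd 1" by (metis dvd_triv_right)
    then show False using ord by simp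
  qed
  ultimately have "P H0" by (auto simp: P_def)
  moreover have "card H < Suc (card (carrier G))" if "P H" for H
    using that fin by (auto simp: P_def less_Suc_eq_le intro!: card_mono dest: subgroup.subset)
  ultimately obtain H where H: "P H" "\<And>H'. P H' \<Longrightarrow> card H' \<le> card H"
    using ex_has_greatest_nat[of P H0 card "Suc (card (carrier G))"] by auto
  obtain \<chi> where \<chi>: "character_on H \<chi>" "\<chi> x \<noteq> 1" using H(1) by (auto simp: P_def)
  have sub: "subgroup H G" "x \<in> H" using H(1) by (auto simp: P_def)
  have "H = carrier G"
  proof (rule ccontr)
    assume "H \<noteq> carrier G"
    then obtain a where a: "a \<in> carrier G" "a \<notin> H" using subgroup.subset[OF sub(1)] by auto
    obtain m :: nat where m: "m > 0" "a [^] m \<in> H" "\<And>j :: nat. a [^] j \<in> H \<Longrightarrow> m dvd j"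
      using ex_min_power_in_subgroup[OF fin sub(1) a(1)] by blast
    define z where "z = \<chi> (a [^] m)"
    have "z \<noteq> 0" using character_on_inv[OF sub(1) \<chi>(1) m(2)] by (auto simp: z_def)
    obtain \<omega>' where "\<omega>' ^ m = z"
      using card_nth_roots[OF \<open>z \<noteq> 0\<close> m(1)] m(1) by (metis (mono_tags) card.empty empty_Collect_eq less_irrefl)
    then obtain H' \<chi>' where H': "subgroup H' G" "H \<subseteq> H'" "a \<in> H'" "character_on H' \<chi>'"
        "\<forall>h\<in>H. \<chi>' h = \<chi> h"
      using character_on_extend[OF sub(1) \<chi>(1) a(1) m] unfolding z_def by blast
    then have "P H'" using sub \<chi> by (auto simp: P_def intro!: exI[of _ \<chi>'])
    moreover have "H \<subset> H'" using H' a by auto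
    then have "card H < card H'"
      using H'(1) fin by (intro psubset_card_mono) (auto dest: subgroup.subset finite_subset)
    ultimately show False using H(2) by (simp add: leD)
  qed
  then show ?thesis using \<chi> by auto
qed

text \<open>
  For each \<open>y \<noteq> \<one>\<close> choose a character \<open>\<chi>\<^sub>y\<close> with \<open>\<chi>\<^sub>y y \<noteq> 1\<close>. The product over \<open>y\<close> of the geometric
  sums \<open>(\<Sum>j<n. \<chi>\<^sub>y x ^ j)\<close> vanishes unless \<open>x = \<one>\<close>, because its factor at \<open>y = x\<close> does; at \<open>\<one>\<close> it is
  a power of the group order \<open>n\<close>. Multiplied out, it is a sum of characters. This is column
  orthogonality for a family in which each character may occur repeatedly, with a constant whose
  prime factors all divide \<open>n\<close>.
\<close>

lemma character_family:
  assumes fin: "finite (carrier G)"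
  obtains W :: "('a \<Rightarrow> nat) set" and \<psi> :: "('a \<Rightarrow> nat) \<Rightarrow> 'a \<Rightarrow> complex" and r :: nat
  where "\<And>w. w \<in> W \<Longrightarrow> character (\<psi> w)"
    "\<And>x. x \<in> carrier G \<Longrightarrow>
       (\<Sum>w\<in>W. \<psi> w x) = (if x = \<one> then of_nat (card (carrier G) ^ r) else 0)"
proof -
  define n where "n = card (carrier G)"
  define Y where "Y = carrier G - {\<one>}"
  have fY: "finite Y" using fin by (simp add: Y_def)
  obtain \<chi> where \<chi>: "\<And>y. y \<in> Y \<Longrightarrow> character (\<chi> y) \<and> \<chi> y y \<noteq> 1"
    using character_separates[OF fin] unfolding Y_def by (metis DiffE insertI1)
  define \<psi> where "\<psi> w x = (\<Prod>y\<in>Y. \<chi> y x ^ w y)" for w :: "'a \<Rightarrow> nat" and x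
  define W where "W = (Y \<rightarrow>\<^sub>E {..<n})"
  have "character (\<psi> w)" for w
    unfolding character_on_def
  proof (intro conjI ballI)
    show "\<psi> w \<one> = 1" unfolding \<psi>_def
      using \<chi> by (intro prod.neutral) (auto simp: character_on_def)
    fix x y assume xy: "x \<in> carrier G" "y \<in> carrier G"
    have "\<psi> w (x \<otimes> y) = (\<Prod>u\<in>Y. \<chi> u x ^ w u * \<chi> u y ^ w u)" unfolding \<psi>_def
      using \<chi> xy by (intro prod.cong) (auto simp: character_on_def power_mult_distrib)
    then show "\<psi> w (x \<otimes> y) = \<psi> w x * \<psi> w y" by (simp add: \<psi>_def prod.distrib)
  qed
  moreover have "(\<Sum>w\<in>W. \<psi> w x) = (if x = \<one> then of_nat (n ^ card Y) else 0)"
    if x: "x \<in> carrier G" for x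
  proof -
    have "(\<Sum>w\<in>W. \<psi> w x) = (\<Prod>y\<in>Y. \<Sum>j<n. \<chi> y x ^ j)"
      unfolding \<psi>_def W_def using fY by (subst prod_sum_PiE) auto
    also have "\<dots> = (if x = \<one> then of_nat (n ^ card Y) else 0)"
    proof (cases "x = \<one>")
      case True
      have "(\<Prod>y\<in>Y. \<Sum>j<n. \<chi> y x ^ j) = (\<Prod>y\<in>Y. of_nat n)"
        using \<chi> True by (intro prod.cong) (auto simp: character_on_def)
      then show ?thesis using True by simp
    next
      case False
      then have xY: "x \<in> Y" using x by (simp add: Y_def)
      have "\<chi> x x ^ n = \<chi> x (x [^] n)"
        using \<chi>[OF xY] x character_on_pow[OF subgroup_self, of "\<chi> x" x n] by simp
      also have "\<dots> = 1" using pow_order_eq_1[OF x] \<chi>[OF xY] by (simp add: n_def Coset.order_def character_on_def)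
      finally have "(\<Sum>j<n. \<chi> x x ^ j) = 0" using \<chi>[OF xY] by (simp add: geometric_sum)
      then show ?thesis using xY fY False by (auto intro!: prod_zero)
    qed
    finally show ?thesis .
  qed
  ultimately show thesis using that[of W \<psi> "card Y"] by (auto simp: n_def)
qed

section \<open>Eigenvalues as character sums\<close>

lemma character_root_of_unity:
  assumes "character \<chi>" "x \<in> carrier G"
  shows "\<chi> x ^ card (carrier G) = 1"
  using character_on_pow[OF subgroup_self assms, of "card (carrier G)"] pow_order_eq_1[OF assms(2)]
    assms(1) by (simp add: Coset.order_def character_on_def)

lemma fourier_inversion:
  assumes fin: "finite (carrier G)"
    and W: "\<And>w. w \<in> W \<Longrightarrow> character (\<psi> w)"
      "\<And>x. x \<in> carrier G \<Longrightarrow> (\<Sum>w\<in>W. \<psi> w x) = (if x = \<one> then C else 0)"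
    and y: "y \<in> carrier G"
  shows "(\<Sum>w\<in>W. (\<Sum>s\<in>carrier G. f s * \<psi> w s) * \<psi> w (inv y)) = C * f y"
proof -
  have "(\<Sum>w\<in>W. (\<Sum>s\<in>carrier G. f s * \<psi> w s) * \<psi> w (inv y)) =
      (\<Sum>w\<in>W. \<Sum>s\<in>carrier G. f s * \<psi> w (s \<otimes> inv y))"
    using W(1) y by (intro sum.cong) (auto simp: sum_distrib_left sum_distrib_right character_on_def mult_ac)
  also have "\<dots> = (\<Sum>s\<in>carrier G. f s * (\<Sum>w\<in>W. \<psi> w (s \<otimes> inv y)))"
    by (subst sum.swap) (simp add: sum_distrib_left)
  also have "\<dots> = (\<Sum>s\<in>carrier G. if s = y then C * f y else 0)"
  proof (rule sum.cong)
    fix s assume s: "s \<in> carrier G"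
    then have "s \<otimes> inv y = \<one> \<longleftrightarrow> s = y"
      using y by (metis inv_equality inv_inv inv_closed r_inv)
    then show "f s * (\<Sum>w\<in>W. \<psi> w (s \<otimes> inv y)) = (if s = y then C * f y else 0)"
      using W(2)[of "s \<otimes> inv y"] s y by simp
  qed simp
  also have "\<dots> = C * f y" using fin y by simp
  finally show ?thesis .
qed

text \<open>
  A character is an eigenvector of the matrix, with its character sum as eigenvalue. Conversely, by
  Fourier inversion an eigenvector \<open>x\<close> has a nonzero Fourier coefficient at some
  character \<open>\<chi>\<close>; applying that coefficient to the eigenvalue equation shows that \<open>\<mu>\<close> is the sum for \<open>\<chi>\<close>.
\<close>

lemma eigenvalue_iff_character_sum:
  fixes f :: "'a \<Rightarrow> complex"
  assumes fin: "finite (carrier G)"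
    and M: "\<And>u v. u \<in> carrier G \<Longrightarrow> v \<in> carrier G \<Longrightarrow> M u v = f (v \<otimes> inv u)"
  shows "eigenvalue_on (carrier G) M \<mu> \<longleftrightarrow> (\<exists>\<chi>. character \<chi> \<and> \<mu> = (\<Sum>s\<in>carrier G. f s * \<chi> s))"
proof
  assume "\<exists>\<chi>. character \<chi> \<and> \<mu> = (\<Sum>s\<in>carrier G. f s * \<chi> s)"
  then obtain \<chi> where \<chi>: "character \<chi>" "\<mu> = (\<Sum>s\<in>carrier G. f s * \<chi> s)" by blast
  show "eigenvalue_on (carrier G) M \<mu>"
    unfolding eigenvalue_on_def
  proof (intro exI[of _ \<chi>] conjI ballI)
    show "\<exists>v\<in>carrier G. \<chi> v \<noteq> 0"
      using \<chi>(1) by (intro bexI[of _ \<one>]) (auto simp: character_on_def)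
    fix u assume u: "u \<in> carrier G"
    have bij: "bij_betw (\<lambda>s. s \<otimes> u) (carrier G) (carrier G)"
      using u by (intro bij_betwI[where g = "\<lambda>v. v \<otimes> inv u"]) (auto simp: m_assoc)
    have "(\<Sum>v\<in>carrier G. M u v * \<chi> v) = (\<Sum>v\<in>carrier G. f (v \<otimes> inv u) * \<chi> v)"
      using M u by simp
    also have "\<dots> = (\<Sum>s\<in>carrier G. f (s \<otimes> u \<otimes> inv u) * \<chi> (s \<otimes> u))"
      by (rule sum.reindex_bij_betw[OF bij, symmetric])
    also have "\<dots> = (\<Sum>s\<in>carrier G. f s * \<chi> s * \<chi> u)"
      using u \<chi>(1) by (intro sum.cong) (auto simp: m_assoc character_on_def)
    finally show "(\<Sum>v\<in>carrier G. M u v * \<chi> v) = \<mu> * \<chi> u"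
      by (simp add: \<chi>(2) sum_distrib_right)
  qed
next
  assume "eigenvalue_on (carrier G) M \<mu>"
  then obtain x w0 where w0: "w0 \<in> carrier G" "x w0 \<noteq> 0"
    and ev: "\<And>u. u \<in> carrier G \<Longrightarrow> (\<Sum>v\<in>carrier G. M u v * x v) = \<mu> * x u"
    by (auto simp: eigenvalue_on_def)
  define xh where "xh \<chi> = (\<Sum>u\<in>carrier G. \<chi> (inv u) * x u)" for \<chi>
  have key: "\<mu> * xh \<chi> = (\<Sum>s\<in>carrier G. f s * \<chi> s) * xh \<chi>" if \<chi>: "character \<chi>" for \<chi>
  proof -
    have "\<mu> * xh \<chi> = (\<Sum>u\<in>carrier G. \<chi> (inv u) * (\<mu> * x u))"
      by (simp add: xh_def sum_distrib_left mult_ac)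
    also have "\<dots> = (\<Sum>u\<in>carrier G. \<Sum>v\<in>carrier G. \<chi> (inv u) * f (v \<otimes> inv u) * x v)"
      by (intro sum.cong refl) (simp flip: ev add: M sum_distrib_left mult_ac)
    also have "\<dots> = (\<Sum>v\<in>carrier G. \<Sum>u\<in>carrier G. \<chi> (inv u) * f (v \<otimes> inv u) * x v)"
      by (rule sum.swap)
    also have "\<dots> = (\<Sum>v\<in>carrier G. (\<Sum>s\<in>carrier G. f s * \<chi> s) * (\<chi> (inv v) * x v))"
    proof (rule sum.cong)
      fix v assume v: "v \<in> carrier G"
      have bij: "bij_betw (\<lambda>s. inv s \<otimes> v) (carrier G) (carrier G)"
      proof (rule bij_betwI[where g = "\<lambda>u. v \<otimes> inv u"])
        show "v \<otimes> inv (inv s \<otimes> v) = s" if "s \<in> carrier G" for s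
          using v that by (simp add: inv_mult_group m_assoc[symmetric])
        show "inv (v \<otimes> inv u) \<otimes> v = u" if "u \<in> carrier G" for u
          using v that by (simp add: inv_mult_group m_assoc)
      qed (use v in auto)
      have "(\<Sum>u\<in>carrier G. \<chi> (inv u) * f (v \<otimes> inv u) * x v) =
          (\<Sum>s\<in>carrier G. \<chi> (inv (inv s \<otimes> v)) * f (v \<otimes> inv (inv s \<otimes> v)) * x v)"
        by (rule sum.reindex_bij_betw[OF bij, symmetric])
      also have "\<dots> = (\<Sum>s\<in>carrier G. f s * \<chi> s * (\<chi> (inv v) * x v))"
        using v \<chi> by (intro sum.cong)
          (auto simp: inv_mult_group m_assoc[symmetric] character_on_def)
      finally show "(\<Sum>u\<in>carrier G. \<chi> (inv u) * f (v \<otimes> inv u) * x v) =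
          (\<Sum>s\<in>carrier G. f s * \<chi> s) * (\<chi> (inv v) * x v)"
        by (simp add: sum_distrib_right)
    qed simp
    finally show ?thesis by (simp add: xh_def sum_distrib_left)
  qed
  obtain W :: "('a \<Rightarrow> nat) set" and \<psi> r where W: "\<And>w. w \<in> W \<Longrightarrow> character (\<psi> w)"
    "\<And>x. x \<in> carrier G \<Longrightarrow>
       (\<Sum>w\<in>W. \<psi> w x) = (if x = \<one> then of_nat (card (carrier G) ^ r) else 0)"
    using character_family[OF fin] by blast
  have xh: "xh \<chi> = (\<Sum>s\<in>carrier G. x (inv s) * \<chi> s)" for \<chi>
  proof -
    have bij: "bij_betw (\<lambda>s. inv s) (carrier G) (carrier G)"
      by (intro bij_betwI[where g = "\<lambda>s. inv s"]) auto
    have "xh \<chi> = (\<Sum>s\<in>carrier G. \<chi> (inv (inv s)) * x (inv s))"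
      unfolding xh_def by (rule sum.reindex_bij_betw[OF bij, symmetric])
    also have "\<dots> = (\<Sum>s\<in>carrier G. x (inv s) * \<chi> s)" by (intro sum.cong) auto
    finally show ?thesis .
  qed
  have "(\<Sum>w\<in>W. xh (\<psi> w) * \<psi> w w0) = of_nat (card (carrier G) ^ r) * x w0"
    using fourier_inversion[OF fin W inv_closed[OF w0(1)], of "\<lambda>s. x (inv s)"] w0(1)
    by (simp add: xh)
  also have "\<dots> \<noteq> 0" using w0 fin by auto
  finally obtain w where "w \<in> W" "xh (\<psi> w) \<noteq> 0"
    by (metis (no_types, lifting) mult_zero_left sum.neutral)
  then show "\<exists>\<chi>. character \<chi> \<and> \<mu> = (\<Sum>s\<in>carrier G. f s * \<chi> s)"
    using key W(1) by (intro exI[of _ "\<psi> w"]) auto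
qed

section \<open>Integrality and power maps\<close>

lemma fourth_roots_power:
  assumes "z \<in> {0, 1, \<i>, -\<i>}" "odd k" shows "z ^ k \<in> {0, 1, \<i>, - \<i>}"
proof -
  obtain j where k: "k = 2 * j + 1" using assms(2) by (elim oddE)
  have "z ^ k = (z\<^sup>2) ^ j * z" by (simp add: k power_mult)
  moreover have "z\<^sup>2 \<in> {0, 1, -1}" using assms(1) by auto
  moreover have "(-1 :: complex) ^ j \<in> {1, -1}" by (cases "even j") auto
  ultimately show ?thesis using assms(1) by (cases "j = 0") (auto simp: power_0_left)
qed

text \<open>
  The squared distances between the possible values of a connection function have no odd prime factor.
\<close>

lemma fourth_roots_dist:
  assumes "a \<in> {0, 1, \<i>, -\<i>}" "b \<in> {0, 1, \<i>, - \<i>}"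
  shows "\<exists>e :: nat. e \<in> {0, 1, 2, 4} \<and> (a - b) * cnj (a - b) = of_nat e"
proof -
  have "\<forall>a\<in>{0, 1, \<i>, -\<i>}. \<forall>b\<in>{0, 1, \<i>, -\<i>}.
      (a - b) * cnj (a - b) = of_nat 0 \<or> (a - b) * cnj (a - b) = of_nat 1 \<or>
      (a - b) * cnj (a - b) = of_nat 2 \<or> (a - b) * cnj (a - b) = of_nat 4"
    by (simp add: complex_eq_iff)
  then show ?thesis using assms by blast
qed

text \<open>
  The inversion formula writes \<open>C * f x\<close>, for a power \<open>C\<close> of the group order, as an integral combination of the character values
  \<open>\<psi> w (inv x)\<close>. Taking \<open>p\<close>-th powers modulo \<open>p\<close> fixes the integer coefficients, by Fermat's little
  theorem, and sends the values to those at \<open>inv (x [^] p)\<close>, which yields \<open>C * f (x [^] p)\<close>.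
\<close>

lemma frobenius_congruence:
  assumes fin: "finite (carrier G)" and f: "\<And>x. x \<in> carrier G \<Longrightarrow> f x \<in> {0, 1, \<i>, -\<i>}"
    and int: "\<And>\<chi>. character \<chi> \<Longrightarrow> (\<Sum>s\<in>carrier G. f s * \<chi> s) \<in> \<int>"
    and p: "prime p" and x: "x \<in> carrier G"
  shows "\<exists>r. \<exists>\<rho>\<in>cyclotomic_ints (4 * card (carrier G)).
    of_nat (card (carrier G) ^ r) * (f x ^ p - f (x [^] p)) = of_nat p * \<rho>"
proof -
  define N where "N = 4 * card (carrier G)"
  obtain W :: "('a \<Rightarrow> nat) set" and \<psi> r where W: "\<And>w. w \<in> W \<Longrightarrow> character (\<psi> w)"
    "\<And>x. x \<in> carrier G \<Longrightarrow>
       (\<Sum>w\<in>W. \<psi> w x) = (if x = \<one> then of_nat (card (carrier G) ^ r) else 0)"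
    using character_family[OF fin] by blast
  define C where "C = card (carrier G) ^ r"
  have "\<forall>w\<in>W. \<exists>c. (\<Sum>s\<in>carrier G. f s * \<psi> w s) = of_int c"
    using int W(1) by (blast elim: Ints_cases)
  then obtain c where c: "\<And>w. w \<in> W \<Longrightarrow> (\<Sum>s\<in>carrier G. f s * \<psi> w s) = of_int (c w)"
    by metis
  have inversion: "of_nat C * f y = (\<Sum>w\<in>W. of_int (c w) * \<psi> w (inv y))" if "y \<in> carrier G" for y
    using fourier_inversion[OF fin W that, of f] c by (simp add: C_def)
  have \<psi>R: "\<psi> w y \<in> cyclotomic_ints N" if "w \<in> W" "y \<in> carrier G" for w y
    using character_root_of_unity[OF W(1)[OF that(1)] that(2)]
    by (intro cyclotomic_ints.root) (simp add: N_def mult.commute[of 4] power_mult)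
  have fR: "f x \<in> cyclotomic_ints N"
  proof -
    have "f x = 0 \<or> f x ^ 4 = 1" using f[OF x] by (auto simp: power4_eq_xxxx)
    then show ?thesis
    proof
      assume "f x ^ 4 = 1"
      then show ?thesis by (intro cyclotomic_ints.root) (simp add: N_def power_mult)
    qed simp
  qed
  obtain d where d: "\<And>w. c w ^ p = c w + int p * d w"
    using choice[of "\<lambda>w d. c w ^ p = c w + int p * d"] fermat_little_int[OF p] by blast
  obtain d0 where d0: "int C ^ p = int C + int p * d0"
    using fermat_little_int[OF p] by blast
  have "of_int (c w) * \<psi> w (inv x) \<in> cyclotomic_ints N" if "w \<in> W" for w
    using \<psi>R[OF that] x by (intro cyclotomic_ints_mult cyclotomic_ints_of_int) simp
  then obtain r1 where r1: "r1 \<in> cyclotomic_ints N"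
    "(\<Sum>w\<in>W. of_int (c w) * \<psi> w (inv x)) ^ p =
      (\<Sum>w\<in>W. (of_int (c w) * \<psi> w (inv x)) ^ p) + of_nat p * r1"
    using freshman_dream_sum[OF p, of W "\<lambda>w. of_int (c w) * \<psi> w (inv x)" N] by blast
  define r2 where "r2 = (\<Sum>w\<in>W. of_int (d w) * \<psi> w (inv (x [^] p)))"
  have r2: "r2 \<in> cyclotomic_ints N" unfolding r2_def using \<psi>R x
    by (auto intro!: cyclotomic_ints_sum cyclotomic_ints_mult cyclotomic_ints_of_int)
  have "(\<Sum>w\<in>W. (of_int (c w) * \<psi> w (inv x)) ^ p) =
      (\<Sum>w\<in>W. (of_int (c w) + of_nat p * of_int (d w)) * \<psi> w (inv (x [^] p)))"
  proof (rule sum.cong)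
    fix w assume w: "w \<in> W"
    have "\<psi> w (inv x) ^ p = \<psi> w (inv (x [^] p))"
      using character_on_pow[OF subgroup_self W(1)[OF w], of "inv x" p] x by (simp add: nat_pow_inv)
    moreover have "of_int (c w) ^ p = (of_int (c w) + of_nat p * of_int (d w) :: complex)"
      using arg_cong[OF d[of w], of "of_int :: int \<Rightarrow> complex"] by simp
    ultimately show "(of_int (c w) * \<psi> w (inv x)) ^ p =
        (of_int (c w) + of_nat p * of_int (d w)) * \<psi> w (inv (x [^] p))"
      by (simp add: power_mult_distrib)
  qed simp
  also have "\<dots> = of_nat C * f (x [^] p) + of_nat p * r2"
    using x by (simp add: inversion r2_def distrib_right sum.distrib sum_distrib_left mult.assoc)
  finally have "(of_nat C * f x) ^ p = of_nat C * f (x [^] p) + of_nat p * r2 + of_nat p * r1"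
    using r1(2) x by (simp add: inversion)
  moreover have "(of_nat C :: complex) ^ p = of_nat C + of_nat p * of_int d0"
    using arg_cong[OF d0, of "of_int :: int \<Rightarrow> complex"] by simp
  ultimately have "of_nat C * (f x ^ p - f (x [^] p)) = of_nat p * (r2 + r1 - of_int d0 * f x ^ p)"
    by (simp add: power_mult_distrib algebra_simps)
  moreover have "r2 + r1 - of_int d0 * f x ^ p \<in> cyclotomic_ints N"
    by (intro cyclotomic_ints.diff cyclotomic_ints_add cyclotomic_ints_mult cyclotomic_ints_power
        cyclotomic_ints_of_int fR r1 r2)
  ultimately show ?thesis unfolding C_def N_def by blast
qed

text \<open>
  Multiplying the congruence by its complex conjugate gives \<open>C\<^sup>2 * e = p\<^sup>2 * (\<rho> * cnj \<rho>)\<close> with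
  \<open>e \<in> {0, 1, 2, 4}\<close>. The factor \<open>\<rho> * cnj \<rho>\<close> is a rational cyclotomic integer, hence an integer, so
  the odd prime \<open>p\<close> divides \<open>e\<close>, and \<open>e = 0\<close>.
\<close>

lemma frobenius_invariance:
  assumes fin: "finite (carrier G)" and f: "\<And>x. x \<in> carrier G \<Longrightarrow> f x \<in> {0, 1, \<i>, -\<i>}"
    and int: "\<And>\<chi>. character \<chi> \<Longrightarrow> (\<Sum>s\<in>carrier G. f s * \<chi> s) \<in> \<int>"
    and p: "prime p" "\<not> p dvd 2 * card (carrier G)" and x: "x \<in> carrier G"
  shows "f (x [^] p) = f x ^ p"
proof -
  define N where "N = 4 * card (carrier G)"
  have N: "N > 0" using fin by (auto simp: N_def card_gt_0_iff)
  obtain r \<rho> where \<rho>: "\<rho> \<in> cyclotomic_ints N"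
    "of_nat (card (carrier G) ^ r) * (f x ^ p - f (x [^] p)) = of_nat p * \<rho>"
    using frobenius_congruence[OF fin f int p(1) x] by (auto simp: N_def)
  define C where "C = card (carrier G) ^ r"
  have pC: "\<not> p dvd C" using p prime_dvd_power[OF p(1)] by (auto simp: C_def)
  have "\<not> p dvd 2" using p(2) by (meson dvd_mult2)
  have "odd p" using \<open>\<not> p dvd 2\<close> p(1) primes_dvd_imp_eq two_is_prime_nat by blast
  obtain e :: nat where e: "e \<in> {0, 1, 2, 4}"
    "(f x ^ p - f (x [^] p)) * cnj (f x ^ p - f (x [^] p)) = of_nat e"
    using fourth_roots_dist[OF fourth_roots_power[OF f[OF x] \<open>odd p\<close>] f[of "x [^] p"]] x by auto
  have "of_nat C ^ 2 * of_nat e = of_nat p ^ 2 * (\<rho> * cnj \<rho>)"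
  proof -
    have "of_nat C ^ 2 * of_nat e =
        (of_nat C * (f x ^ p - f (x [^] p))) * cnj (of_nat C * (f x ^ p - f (x [^] p)))"
      by (simp flip: e(2) add: power2_eq_square)
    also have "of_nat C * (f x ^ p - f (x [^] p)) = of_nat p * \<rho>"
      unfolding C_def by (rule \<rho>(2))
    finally show ?thesis by (simp add: power2_eq_square mult_ac)
  qed
  moreover have "p > 0" using p(1) prime_gt_0_nat by blast
  ultimately have eq: "\<rho> * cnj \<rho> = of_nat (C ^ 2 * e) / of_nat (p ^ 2)"
    by (simp add: field_simps)
  \<comment> \<open>The left-hand side is also a cyclotomic integer, so it is an integer.\<close>
  have "\<rho> * cnj \<rho> \<in> \<rat>" unfolding eq by (intro Rats_divide) auto
  then have "\<rho> * cnj \<rho> \<in> \<int>"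
    using cyclotomic_ints_rational[OF N] \<rho>(1) cyclotomic_ints_mult cyclotomic_ints_cnj by blast
  then obtain k where "\<rho> * cnj \<rho> = of_int k" by (elim Ints_cases)
  then have "of_int (int (C ^ 2 * e)) = (of_int (int (p ^ 2) * k) :: complex)"
    using eq \<open>p > 0\<close> by (simp add: field_simps)
  then have "int (C ^ 2 * e) = int (p ^ 2) * k" by (rule of_int_eq_iff[THEN iffD1])
  then have "int p dvd int (C ^ 2 * e)" by (simp add: power2_eq_square)
  then have "p dvd C ^ 2 * e" by (rule int_dvd_int_iff[THEN iffD1])
  then have "p dvd e" using pC p(1) by (auto simp: prime_dvd_mult_iff dest: prime_dvd_power)
  have "e = 0"
  proof (rule ccontr)
    assume "e \<noteq> 0"
    then have "e dvd 2 ^ 2" using e(1) by auto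
    then have "p dvd 2 ^ 2" using \<open>p dvd e\<close> dvd_trans by blast
    then show False using \<open>\<not> p dvd 2\<close> p(1) prime_dvd_power by blast
  qed
  then have "f x ^ p - f (x [^] p) = 0"
    using e(2) by (simp only: of_nat_0 mult_eq_0_iff complex_cnj_zero_iff disj_absorb)
  then show ?thesis by simp
qed

lemma power_invariance:
  assumes fin: "finite (carrier G)" and f: "\<And>x. x \<in> carrier G \<Longrightarrow> f x \<in> {0, 1, \<i>, -\<i>}"
    and int: "\<And>\<chi>. character \<chi> \<Longrightarrow> (\<Sum>s\<in>carrier G. f s * \<chi> s) \<in> \<int>"
    and k: "coprime k (2 * card (carrier G))" and x: "x \<in> carrier G"
  shows "f (x [^] k) = f x ^ k"
  using k x
proof (induction k arbitrary: x rule: less_induct)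
  case (less k)
  show ?case
  proof (cases "k = 1")
    case False
    then obtain p where "prime p" "p dvd k" using prime_factor_nat[of k] by blast
    moreover from \<open>p dvd k\<close> obtain q where "k = p * q" by (elim dvdE)
    ultimately have p: "prime p" "k = p * q" by simp_all
    have "k \<noteq> 0"
    proof
      assume "k = 0"
      then show False using less.prems(1) by simp
    qed
    then have "q < k" using p prime_gt_1_nat[OF p(1)] by auto
    have cop: "coprime p (2 * card (carrier G))" "coprime q (2 * card (carrier G))"
      using less.prems(1) by (auto simp: p(2))
    have "\<not> p dvd 2 * card (carrier G)"
      using cop(1) p(1) by (metis coprime_absorb_left not_prime_unit)
    then have "f (x [^] p) = f x ^ p" using frobenius_invariance[OF fin f int p(1)] less.prems(2) by blast
    moreover have "f ((x [^] p) [^] q) = f (x [^] p) ^ q"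
      using less.IH[OF \<open>q < k\<close> cop(2), of "x [^] p"] less.prems(2) by simp
    ultimately show ?thesis using less.prems(2) by (simp add: p(2) nat_pow_pow power_mult)
  qed (use less.prems in simp)
qed

lemma pow_cong:
  assumes "x \<in> carrier G" "[i = j] (mod ord x)" shows "x [^] (i :: nat) = x [^] j"
proof -
  have "x [^] k = x [^] (k mod ord x)" for k :: nat
  proof -
    have "x [^] k = x [^] (ord x * (k div ord x) + k mod ord x)" by simp
    also have "\<dots> = (x [^] ord x) [^] (k div ord x) \<otimes> x [^] (k mod ord x)"
      using assms(1) by (simp only: nat_pow_mult nat_pow_pow)
    finally show ?thesis using assms(1) by simp
  qed
  then show ?thesis using assms(2) by (metis cong_def)
qed

text \<open>
  The power map with exponent \<open>k\<close> is undone by an inverse of \<open>k\<close> modulo \<open>M\<close>. Taking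
  twice the group order for \<open>M\<close> keeps both exponents odd.
\<close>

lemma coprime_power_inverse:
  assumes "coprime k M" and M: "card (carrier G) dvd M"
  shows "\<exists>k'. coprime k' M \<and> (\<forall>x\<in>carrier G. (x [^] k) [^] k' = x) \<and>
    (\<forall>x\<in>carrier G. (x [^] k') [^] k = x)"
proof -
  obtain k' where k': "[k * k' = 1] (mod M)"
    using cong_solve_coprime_nat[OF assms(1)] by auto
  have pow: "x [^] (k * k') = x" if "x \<in> carrier G" for x
  proof -
    have "ord x dvd M"
      using ord_dvd_group_order[OF that] M unfolding Coset.order_def by (rule dvd_trans)
    then have "[k * k' = 1] (mod ord x)" using cong_dvd_modulus_nat[OF k'] by blast
    then show ?thesis using pow_cong[OF that] that by simp
  qed
  have "[k' * k = 1] (mod M)" using k' by (simp add: mult.commute)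
  then have "coprime k' M" using coprime_iff_invertible_nat[of k' M] by auto
  then show ?thesis using pow by (intro exI[of _ k']) (simp add: nat_pow_pow mult.commute[of k' k])
qed

text \<open>
  For each \<open>k\<close> coprime to \<open>4 * n\<close>, where \<open>n\<close> is the group order, substituting \<open>s [^] k\<close> for \<open>s\<close> shows that
  the sum \<open>l\<close> of the numbers \<open>f s * \<chi> s\<close> equals the sum of their \<open>k\<close>-th powers. Summing over all such \<open>k\<close>
  makes a multiple of \<open>l\<close> a sum of Ramanujan sums, as each \<open>f s * \<chi> s\<close> is zero or a root of unity.
\<close>

lemma character_sum_Ints:
  assumes fin: "finite (carrier G)" and f: "\<And>x. x \<in> carrier G \<Longrightarrow> f x \<in> {0, 1, \<i>, -\<i>}"
    and inv: "\<And>k x. coprime k (2 * card (carrier G)) \<Longrightarrow> x \<in> carrier G \<Longrightarrow> f (x [^] k) = f x ^ k"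
    and \<chi>: "character \<chi>"
  shows "(\<Sum>s\<in>carrier G. f s * \<chi> s) \<in> \<int>"
proof -
  define N where "N = 4 * card (carrier G)"
  define l where "l = (\<Sum>s\<in>carrier G. f s * \<chi> s)"
  have N: "N > 0" using fin by (auto simp: N_def card_gt_0_iff)
  have root: "f s * \<chi> s = 0 \<or> (f s * \<chi> s) ^ N = 1" if "s \<in> carrier G" for s
  proof -
    have "f s = 0 \<or> f s ^ 4 = 1" using f[OF that] by (auto simp: power4_eq_xxxx)
    moreover have "\<chi> s ^ N = 1" using character_root_of_unity[OF \<chi> that]
      by (simp add: N_def mult.commute[of 4] power_mult)
    ultimately show ?thesis by (auto simp: power_mult_distrib N_def power_mult)
  qed
  have conj: "(\<Sum>s\<in>carrier G. (f s * \<chi> s) ^ k) = l" if k: "k \<in> totatives N" for k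
  proof -
    have cop: "coprime k (2 * card (carrier G))" "coprime k (card (carrier G))"
      using k by (auto simp: in_totatives_iff N_def)
    obtain k' :: nat where k': "\<forall>x\<in>carrier G. (x [^] k) [^] k' = x" "\<forall>x\<in>carrier G. (x [^] k') [^] k = x"
      using coprime_power_inverse[OF cop(2) dvd_refl] by blast
    have bij: "bij_betw (\<lambda>s. s [^] k) (carrier G) (carrier G)"
      using k' by (intro bij_betwI[where g = "\<lambda>s. s [^] k'"]) auto
    have "(\<Sum>s\<in>carrier G. (f s * \<chi> s) ^ k) = (\<Sum>s\<in>carrier G. f (s [^] k) * \<chi> (s [^] k))"
      using inv[OF cop(1)] character_on_pow[OF subgroup_self \<chi>]
      by (intro sum.cong) (auto simp: power_mult_distrib)
    also have "\<dots> = l" unfolding l_def by (rule sum.reindex_bij_betw[OF bij])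
    finally show ?thesis .
  qed
  have "of_nat (card (totatives N)) * l = (\<Sum>k\<in>totatives N. \<Sum>s\<in>carrier G. (f s * \<chi> s) ^ k)"
    by (simp add: conj)
  also have "\<dots> = (\<Sum>s\<in>carrier G. \<Sum>k\<in>totatives N. (f s * \<chi> s) ^ k)" by (rule sum.swap)
  also have "\<dots> \<in> \<int>"
  proof (rule Ints_sum)
    fix s assume s: "s \<in> carrier G"
    show "(\<Sum>k\<in>totatives N. (f s * \<chi> s) ^ k) \<in> \<int>"
    proof (cases "f s * \<chi> s = 0")
      case True
      then have "(\<Sum>k\<in>totatives N. (f s * \<chi> s) ^ k) = 0"
        by (intro sum.neutral) (auto simp: in_totatives_iff power_0_left)
      then show ?thesis by simp
    next
      case False
      then show ?thesis using root[OF s] ramanujan_sum_Ints[OF N] by blast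
    qed
  qed
  finally obtain i where i: "of_nat (card (totatives N)) * l = of_int i" by (elim Ints_cases)
  have "card (totatives N) \<noteq> 0" using N by simp
  then have "l = of_int i / of_nat (card (totatives N))" using i by (simp add: field_simps)
  then have "l \<in> \<rat>" by simp
  moreover have "l \<in> cyclotomic_ints N" unfolding l_def
    using root by (intro cyclotomic_ints_sum) (metis cyclotomic_ints.root cyclotomic_ints_0)
  ultimately show ?thesis using cyclotomic_ints_rational[OF N] unfolding l_def by blast
qed

end

section \<open>Power-closed sets and the two set families\<close>

text \<open>
  Units modulo \<open>m\<close> lift to units modulo \<open>N\<close>: let \<open>t\<close> be the product of the primes that divide \<open>N\<close> but
  not \<open>k\<close>. Then every prime divisor of \<open>N\<close> divides exactly one of \<open>k\<close> and \<open>m * t\<close>.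
\<close>

lemma coprime_lift:
  fixes k m N :: nat
  assumes "coprime k m" "N > 0"
  obtains t where "coprime (k + m * t) N"
proof -
  define Q where "Q = {q. prime q \<and> q dvd N \<and> \<not> q dvd k}"
  have Q: "finite Q" using assms(2) finite_divisors_nat[of N] by (rule_tac finite_subset[of _ "{q. q dvd N}"]) (auto simp: Q_def)
  define t where "t = \<Prod>Q"
  have "coprime (k + m * t) N"
  proof (rule ccontr)
    assume "\<not> coprime (k + m * t) N"
    then have "gcd (k + m * t) N \<noteq> 1" using coprime_iff_gcd_eq_1 by blast
    then obtain q where "prime q" "q dvd gcd (k + m * t) N" using prime_factor_nat by blast
    then have q: "prime q" "q dvd k + m * t" "q dvd N" by simp_all
    show False
    proof (cases "q dvd k")
      case True
      then have "q dvd m * t" using q(2) dvd_add_right_iff by blast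
      moreover have "\<not> q dvd m"
        using True assms(1) q(1) by (meson coprime_common_divisor not_prime_unit)
      ultimately have "q dvd t" using q(1) by (simp add: prime_dvd_mult_iff)
      then obtain q' where "q' \<in> Q" "q dvd q'"
        using prime_dvd_prod_iff[OF Q q(1), of "\<lambda>x. x"] by (auto simp: t_def)
      then have "q \<in> Q" using q(1) primes_dvd_imp_eq[of q q'] by (auto simp: Q_def)
      then show False using True by (simp add: Q_def)
    next
      case False
      then have "q dvd t" unfolding t_def using Q q by (intro dvd_prodI) (auto simp: Q_def)
      then show False using False q(2) by (metis dvd_add_left_iff dvd_mult)
    qed
  qed
  then show thesis by (rule that)
qed

lemma i_power_mod_4:
  "k mod 4 = 1 \<Longrightarrow> \<i> ^ k = \<i>" "k mod 4 = 3 \<Longrightarrow> \<i> ^ k = - \<i>"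
proof -
  have "\<i> ^ k = \<i> ^ (4 * (k div 4) + k mod 4)" by simp
  also have "\<dots> = \<i> ^ (k mod 4)" by (simp only: power_add power_mult i_even_power power4_eq_xxxx) simp
  finally have "\<i> ^ k = \<i> ^ (k mod 4)" .
  then show "k mod 4 = 1 \<Longrightarrow> \<i> ^ k = \<i>" "k mod 4 = 3 \<Longrightarrow> \<i> ^ k = - \<i>"
    by (simp_all add: power3_eq_cube)
qed

context comm_group
begin

text \<open>
  The equivalence, rather than one implication, is what survives complements in the induction.
\<close>

lemma boolean_algebra_power_closed:
  assumes "A \<in> boolean_algebra_of G"
  shows "A \<subseteq> carrier G \<and> (\<forall>k. coprime k (card (carrier G)) \<longrightarrow> (\<forall>x\<in>carrier G. x [^] k \<in> A \<longleftrightarrow> x \<in> A))"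
  using assms
proof induction
  case (subgroup H)
  have "x [^] k \<in> H \<longleftrightarrow> x \<in> H" if k: "coprime k (card (carrier G))" and x: "x \<in> carrier G" for k x
  proof
    obtain k' :: nat where k': "\<forall>x\<in>carrier G. (x [^] k) [^] k' = x"
      using coprime_power_inverse[OF k dvd_refl] by blast
    assume "x [^] k \<in> H"
    then have "(x [^] k) [^] k' \<in> H" by (rule subgroup_nat_pow_closed[OF subgroup])
    then show "x \<in> H" by (simp add: k' x)
  qed (rule subgroup_nat_pow_closed[OF subgroup])
  then show ?case using subgroup.subset[OF subgroup] by blast
qed auto

lemma boolean_algebra_Union:
  assumes "finite \<A>" "\<And>A. A \<in> \<A> \<Longrightarrow> A \<in> boolean_algebra_of G"
  shows "\<Union>\<A> \<in> boolean_algebra_of G"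
  using assms
proof (induction \<A> rule: finite_induct)
  case empty
  have "carrier G - carrier G \<in> boolean_algebra_of G"
    by (intro boolean_algebra_of.compl boolean_algebra_of.subgroup subgroup_self)
  then show ?case by simp
qed (auto intro: boolean_algebra_of.union)

text \<open>
  The generators of a cyclic group are what remains after removing its proper subgroups, all of
  which are cyclic.
\<close>

lemma cyclic_generators_in_boolean_algebra:
  assumes fin: "finite (carrier G)" and x: "x \<in> carrier G"
  shows "{y \<in> generate G {x}. ord y = ord x} \<in> boolean_algebra_of G"
proof -
  have gen: "generate G {y} = {y [^] k | k. k \<in> (UNIV :: nat set)}" if "y \<in> carrier G" for y
    using generate_pow_on_finite_carrier[OF fin that] .
  have genG: "generate G {y} \<subseteq> carrier G" if "y \<in> carrier G" for y
    using that by (intro generate_incl) auto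
  have sub: "generate G {y} \<in> boolean_algebra_of G" if "y \<in> carrier G" for y
    using that by (intro boolean_algebra_of.subgroup generate_is_subgroup) auto
  have dvd: "ord z dvd ord y" if y: "y \<in> carrier G" and "z \<in> generate G {y}" for y z
  proof -
    obtain k :: nat where z: "z = y [^] k" using \<open>z \<in> generate G {y}\<close> gen[OF y] by auto
    have "z [^] ord y = (y [^] ord y) [^] k" using y by (simp add: z nat_pow_pow mult.commute del: pow_ord_eq_1)
    then have "z [^] ord y = \<one>" using y by simp
    then show ?thesis using pow_eq_id[of z "ord y"] y by (simp add: z)
  qed
  have self: "y \<in> generate G {y}" for y by (rule generate.incl) simp
  define \<A> where "\<A> = (\<lambda>y. generate G {y}) ` {y \<in> generate G {x}. ord y \<noteq> ord x}"
  have "{y \<in> generate G {x}. ord y = ord x} = generate G {x} \<inter> (carrier G - \<Union>\<A>)"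
  proof (intro equalityI subsetI)
    fix y assume y: "y \<in> {y \<in> generate G {x}. ord y = ord x}"
    have "y \<notin> \<Union>\<A>"
    proof
      assume "y \<in> \<Union>\<A>"
      then obtain z where z: "z \<in> generate G {x}" "ord z \<noteq> ord x" "y \<in> generate G {z}"
        by (auto simp: \<A>_def)
      then have "ord y dvd ord z" "ord z dvd ord x" using dvd genG[OF x] x by auto
      then show False using y z(2) by (auto intro: dvd_antisym)
    qed
    then show "y \<in> generate G {x} \<inter> (carrier G - \<Union>\<A>)" using y genG[OF x] by auto
  qed (use self in \<open>auto simp: \<A>_def\<close>)
  moreover have "\<Union>\<A> \<in> boolean_algebra_of G"
  proof (rule boolean_algebra_Union)
    show "finite \<A>" unfolding \<A>_def using finite_subset[OF genG[OF x] fin] by auto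
    show "A \<in> boolean_algebra_of G" if "A \<in> \<A>" for A
      using that sub genG[OF x] by (auto simp: \<A>_def)
  qed
  ultimately show ?thesis
    using sub[OF x] by (auto intro: boolean_algebra_of.inter boolean_algebra_of.compl)
qed

text \<open>
  The set \<open>A\<close> contains, with \<open>x\<close>, every generator \<open>x [^] k\<close> of the cyclic group of \<open>x\<close>: here \<open>k\<close> is coprime
  to \<open>ord x\<close> only, and must first be lifted to an exponent coprime to \<open>M\<close>.
\<close>

lemma power_closed_in_boolean_algebra:
  assumes fin: "finite (carrier G)" and A: "A \<subseteq> carrier G" and M: "M > (0 :: nat)"
    and closed: "\<And>k x. coprime k M \<Longrightarrow> x \<in> A \<Longrightarrow> x [^] k \<in> A"
  shows "A \<in> boolean_algebra_of G"
proof -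
  define \<A> where "\<A> = (\<lambda>x. {y \<in> generate G {x}. ord y = ord x}) ` A"
  have "A = \<Union>\<A>"
  proof (intro equalityI subsetI)
    fix x assume "x \<in> A"
    moreover have "x \<in> generate G {x}" by (rule generate.incl) simp
    ultimately show "x \<in> \<Union>\<A>" by (auto simp: \<A>_def)
  next
    fix y assume "y \<in> \<Union>\<A>"
    then obtain x where x: "x \<in> A" "y \<in> generate G {x}" "ord y = ord x" by (auto simp: \<A>_def)
    have xG: "x \<in> carrier G" using x(1) A by auto
    obtain k :: nat where y: "y = x [^] k"
      using x(2) generate_pow_on_finite_carrier[OF fin xG] by auto
    have "coprime k (ord x)"
      using x(3) pow_ord_eq_ord_iff[OF fin xG] by (simp add: y)
    then obtain t where t: "coprime (k + ord x * t) M" using coprime_lift M by blast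
    have "x [^] (k + ord x * t) = y" unfolding y by (rule pow_cong[OF xG]) (simp add: cong_def)
    then show "y \<in> A" using closed[OF t x(1)] by simp
  qed
  moreover have "\<Union>\<A> \<in> boolean_algebra_of G"
  proof (rule boolean_algebra_Union)
    show "finite \<A>" unfolding \<A>_def using finite_subset[OF A fin] by auto
    show "B \<in> boolean_algebra_of G" if "B \<in> \<A>" for B
      using that A cyclic_generators_in_boolean_algebra[OF fin] by (auto simp: \<A>_def)
  qed
  ultimately show ?thesis by simp
qed

section \<open>The connection function\<close>

definition connection :: "'a set \<Rightarrow> 'a \<Rightarrow> complex" where
  "connection S x =
     (if x \<in> S \<and> inv x \<in> S then 1 else if x \<in> S then \<i> else if inv x \<in> S then - \<i> else 0)"

lemma connection_values: "connection S x \<in> {0, 1, \<i>, -\<i>}"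
  by (simp add: connection_def)

lemma connection_eq_1_iff: "connection S x = 1 \<longleftrightarrow> x \<in> S - antisym_part G S"
  by (auto simp: connection_def antisym_part_def complex_eq_iff)

lemma connection_eq_i_iff: "connection S x = \<i> \<longleftrightarrow> x \<in> antisym_part G S"
  by (auto simp: connection_def antisym_part_def complex_eq_iff)

lemma connection_inv: "x \<in> carrier G \<Longrightarrow> connection S (inv x) = cnj (connection S x)"
  by (simp add: connection_def)

lemma hermitian_adj_Cay:
  assumes "u \<in> carrier G" "v \<in> carrier G"
  shows "hermitian_adj (snd (Cay G S)) u v = connection S (v \<otimes> inv u)"
proof -
  have "inv (v \<otimes> inv u) = u \<otimes> inv v" using assms by (simp add: inv_mult_group)
  then show ?thesis using assms by (simp add: hermitian_adj_def Cay_def connection_def)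
qed

text \<open>
  The bridge between the spectrum and the combinatorics of \<open>S\<close>: integrality means that the
  connection function is compatible with all power maps that permute the roots of unity of order
  \<open>4 * n\<close>, for \<open>n\<close> the order of the group.
\<close>

lemma integral_Cay_iff:
  assumes fin: "finite (carrier G)"
  shows "integral_mixed_graph (Cay G S) \<longleftrightarrow>
    (\<forall>k. coprime k (2 * card (carrier G)) \<longrightarrow>
       (\<forall>x\<in>carrier G. connection S (x [^] k) = connection S x ^ k))"
    (is "?L \<longleftrightarrow> ?R")
proof -
  have "?L \<longleftrightarrow> (\<forall>\<chi>. character \<chi> \<longrightarrow> (\<Sum>s\<in>carrier G. connection S s * \<chi> s) \<in> \<int>)"
    unfolding integral_mixed_graph_def
    using eigenvalue_iff_character_sum[where M = "hermitian_adj (snd (Cay G S))" and f = "connection S",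
        OF fin hermitian_adj_Cay]
    by (auto simp: Cay_def)
  also have "\<dots> \<longleftrightarrow> ?R"
  proof
    assume int: "\<forall>\<chi>. character \<chi> \<longrightarrow> (\<Sum>s\<in>carrier G. connection S s * \<chi> s) \<in> \<int>"
    show ?R
    proof (intro allI ballI impI)
      fix k x assume "coprime k (2 * card (carrier G))" "x \<in> carrier G"
      with int show "connection S (x [^] k) = connection S x ^ k"
        by (intro power_invariance[OF fin connection_values]) auto
    qed
  next
    assume ?R
    then show "\<forall>\<chi>. character \<chi> \<longrightarrow> (\<Sum>s\<in>carrier G. connection S s * \<chi> s) \<in> \<int>"
      by (intro allI impI character_sum_Ints[OF fin connection_values]) auto
  qed
  finally show ?thesis .
qed

text \<open>
  If \<open>4\<close> does not divide \<open>ord x\<close>, some admissible \<open>k\<close> satisfies \<open>k mod 4 = 3\<close> and \<open>x [^] k = x\<close>. The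
  invariance then gives \<open>\<i> = \<i> ^ k = -\<i>\<close>.
\<close>

lemma antisym_part_subset_Gamma4:
  assumes fin: "finite (carrier G)" and S: "S \<subseteq> carrier G"
    and inv: "\<And>k x. coprime k (2 * card (carrier G)) \<Longrightarrow> x \<in> carrier G \<Longrightarrow>
      connection S (x [^] k) = connection S x ^ k"
  shows "antisym_part G S \<subseteq> Gamma4 G"
proof
  fix x assume x: "x \<in> antisym_part G S"
  then have xG: "x \<in> carrier G" using S by (auto simp: antisym_part_def)
  have "ord x mod 4 = 0"
  proof (rule ccontr)
    assume m: "ord x mod 4 \<noteq> 0"
    \<comment> \<open>The multiple of \<open>ord x\<close> that is \<open>2\<close> modulo \<open>4\<close>, so that \<open>k0\<close> is \<open>3\<close> modulo \<open>4\<close>.\<close>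
    define c :: nat where "c = (if odd (ord x) then 2 else 1)"
    define k0 where "k0 = 1 + ord x * c"
    have k0: "k0 mod 4 = 3"
    proof (cases "odd (ord x)")
      case True
      then have "(1 + ord x * 2) mod 4 = 3" by presburger
      then show ?thesis using True by (simp add: k0_def c_def)
    next
      case False
      then have "(1 + ord x) mod 4 = 3" using m by presburger
      then show ?thesis using False by (simp add: k0_def c_def)
    qed
    have "coprime k0 (ord x)"
    proof (rule coprimeI)
      fix d assume d: "d dvd k0" "d dvd ord x"
      then have "d dvd ord x * c" by (intro dvd_mult2)
      then show "d dvd 1" using d(1) dvd_add_left_iff[of d "ord x * c" 1] by (simp add: k0_def)
    qed
    moreover have "odd k0" using k0 by presburger
    then have "coprime k0 4" using coprime_power_right_iff[of k0 2 2] by simp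
    ultimately have "coprime k0 (4 * ord x)" by simp
    then obtain t where t: "coprime (k0 + 4 * ord x * t) (2 * card (carrier G))"
      using coprime_lift[of k0 "4 * ord x" "2 * card (carrier G)"] fin xG by (auto simp: card_gt_0_iff)
    define k where "k = k0 + 4 * ord x * t"
    have "k = 1 + ord x * (c + 4 * t)" by (simp add: k_def k0_def algebra_simps)
    then have "[k = 1] (mod ord x)" by (simp only: cong_def mod_mult_self2)
    then have "x [^] k = x" using pow_cong[OF xG] xG by simp
    moreover have "k mod 4 = 3" using k0 by (simp add: k_def mult.assoc)
    then have "\<i> ^ k = - \<i>" by (rule i_power_mod_4)
    ultimately have "connection S x = - \<i>"
      using inv[OF t xG] x by (simp add: k_def connection_eq_i_iff[symmetric])
    moreover have "connection S x = \<i>" using x by (simp add: connection_eq_i_iff)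
    ultimately show False by (simp add: complex_eq_iff)
  qed
  then show "x \<in> Gamma4 G" using xG by (simp add: Gamma4_def)
qed

text \<open>
  An exponent \<open>j\<close> defining \<open>approx_rel\<close> is coprime to \<open>ord x\<close> only. As \<open>4\<close> divides \<open>ord x\<close>, lifting it to an
  exponent coprime to twice the group order keeps it \<open>1\<close> modulo \<open>4\<close>, and \<open>\<i>\<close> to that power is \<open>\<i>\<close>.
\<close>

lemma antisym_part_closed_under_approx:
  assumes fin: "finite (carrier G)" and S: "S \<subseteq> carrier G"
    and inv: "\<And>k x. coprime k (2 * card (carrier G)) \<Longrightarrow> x \<in> carrier G \<Longrightarrow>
      connection S (x [^] k) = connection S x ^ k"
    and x: "x \<in> antisym_part G S"
  shows "approx_class G x \<subseteq> antisym_part G S"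
proof
  fix y assume "y \<in> approx_class G x"
  then obtain j :: int where j: "j mod 4 = 1" "gcd j (int (ord x)) = 1" "y = x [^] j"
    by (auto simp: approx_class_def approx_rel_def G1_def)
  have xG: "x \<in> carrier G" "ord x mod 4 = 0"
    using antisym_part_subset_Gamma4[OF fin S inv] x by (auto simp: Gamma4_def)
  have m: "ord x > 0" using ord_ge_1[OF fin xG(1)] by simp
  define k0 where "k0 = nat (j mod int (ord x))"
  have k0: "int k0 = j mod int (ord x)" using m by (simp add: k0_def)
  have "int (ord x) dvd int k0 - j" unfolding k0 by (simp add: mod_eq_dvd_iff[symmetric])
  then have y: "y = x [^] k0"
    using int_pow_eq[OF xG(1), of j "int k0"] by (simp add: j(3) int_pow_int)
  have "gcd (int k0) (int (ord x)) = 1" unfolding k0 using j(2) by (simp add: gcd.commute gcd_red_int[symmetric])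
  then have "coprime (int k0) (int (ord x))" using coprime_iff_gcd_eq_1 by blast
  then have "coprime k0 (ord x)" by simp
  then obtain t where t: "coprime (k0 + ord x * t) (2 * card (carrier G))"
    using coprime_lift[of k0 "ord x" "2 * card (carrier G)"] fin xG by (auto simp: card_gt_0_iff)
  define k where "k = k0 + ord x * t"
  have "x [^] k = y" unfolding y k_def by (rule pow_cong[OF xG(1)]) (simp add: cong_def)
  moreover have "k mod 4 = 1"
  proof -
    obtain q where q: "ord x = 4 * q" using xG(2) by auto
    have "int k0 mod 4 = j mod 4" unfolding k0 by (simp add: q mod_mod_cancel)
    then have "k0 mod 4 = 1" using j(1) by presburger
    then show ?thesis by (simp add: k_def q mult.assoc)
  qed
  then have "\<i> ^ k = \<i>" by (rule i_power_mod_4)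
  ultimately have "connection S y = \<i>"
    using inv[OF t xG(1)] x by (simp add: k_def[symmetric] connection_eq_i_iff[symmetric])
  then show "y \<in> antisym_part G S" by (simp add: connection_eq_i_iff)
qed

lemma group_exponent_mod_4:
  assumes fin: "finite (carrier G)" and x: "x \<in> Gamma4 G"
  shows "group_exponent G mod 4 = 0"
proof -
  have "0 < card (carrier G) \<and> (\<forall>x\<in>carrier G. x [^] card (carrier G) = \<one>)"
    using fin pow_order_eq_1 by (auto simp: card_gt_0_iff Coset.order_def)
  then have "\<forall>x\<in>carrier G. x [^] group_exponent G = \<one>"
    unfolding group_exponent_def by (rule LeastI2) auto
  then have "ord x dvd group_exponent G" using x pow_eq_id by (auto simp: Gamma4_def)
  moreover have "4 dvd ord x" using x by (auto simp: Gamma4_def)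
  ultimately show ?thesis by (metis dvd_trans dvd_imp_mod_0)
qed

lemma antisym_part_in_DD:
  assumes fin: "finite (carrier G)" and S: "S \<subseteq> carrier G"
    and inv: "\<And>k x. coprime k (2 * card (carrier G)) \<Longrightarrow> x \<in> carrier G \<Longrightarrow>
      connection S (x [^] k) = connection S x ^ k"
  shows "antisym_part G S \<in> DD G"
proof -
  let ?T = "antisym_part G S"
  note sub = antisym_part_subset_Gamma4[OF fin S inv]
  have "finite ?T" using S fin by (auto simp: antisym_part_def intro: finite_subset)
  moreover have "skew_symmetric G ?T"
    using S by (auto simp: skew_symmetric_def antisym_part_def)
  moreover have "?T = (\<Union>x\<in>?T. approx_class G x)"
  proof
    show "?T \<subseteq> (\<Union>x\<in>?T. approx_class G x)"
    proof
      fix x assume x: "x \<in> ?T"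
      have "x \<in> carrier G" "x \<in> Gamma4 G" using sub x by (auto simp: Gamma4_def)
      moreover from this have "x = x [^] (1 :: int)" by simp
      moreover have "1 \<in> G1 (ord x)" by (simp add: G1_def)
      ultimately have "x \<in> approx_class G x"
        unfolding approx_class_def approx_rel_def by blast
      then show "x \<in> (\<Union>x\<in>?T. approx_class G x)" using x by blast
    qed
  qed (use antisym_part_closed_under_approx[OF fin S inv] in blast)
  ultimately have "skew_symmetric G ?T \<and>
      (\<exists>X. finite X \<and> X \<subseteq> Gamma4 G \<and> ?T = (\<Union>x\<in>X. approx_class G x))"
    using sub by (intro conjI exI[of _ ?T]) simp_all
  moreover have "?T = {}" if "group_exponent G mod 4 \<noteq> 0"
  proof (rule ccontr)
    assume "?T \<noteq> {}"
    then obtain x where "x \<in> ?T" by auto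
    then show False using that group_exponent_mod_4[OF fin subsetD[OF sub]] by simp
  qed
  ultimately show ?thesis unfolding DD_def by (cases "group_exponent G mod 4 = 0") simp_all
qed

text \<open>
  The exponent is an integer so that \<open>j = - int k\<close> covers the natural numbers \<open>k\<close> that are \<open>3\<close> modulo \<open>4\<close>.
\<close>

lemma DD_power_closed:
  assumes T: "T \<in> DD G" and x: "x \<in> T"
    and j: "j mod 4 = 1" "coprime j (int (card (carrier G)))" and y: "x [^] (j :: int) \<in> Gamma4 G"
  shows "x [^] j \<in> T"
proof -
  obtain X where X: "X \<subseteq> Gamma4 G" "T = (\<Union>x\<in>X. approx_class G x)"
    using T x by (auto simp: DD_def split: if_splits)
  obtain x0 i where x0: "x0 \<in> X" "i mod 4 = 1" "gcd i (int (ord x0)) = 1" "x = x0 [^] (i :: int)"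
    using x by (auto simp: X(2) approx_class_def approx_rel_def G1_def)
  have x0G: "x0 \<in> carrier G" "x0 \<in> Gamma4 G" using X(1) x0(1) by (auto simp: Gamma4_def)
  have "x [^] j = x0 [^] (i * j)" using x0G by (simp add: x0(4) int_pow_pow)
  moreover have "(i * j) mod 4 = 1" using x0(2) j(1) mod_mult_eq[of i 4 j] by simp
  moreover have "int (ord x0) dvd int (card (carrier G))"
    using ord_dvd_group_order[OF x0G(1)] by (simp add: Coset.order_def)
  then have "coprime j (int (ord x0))" using j(2) coprime_divisors[OF dvd_refl] by blast
  then have "coprime (i * j) (int (ord x0))"
    using x0(3) coprime_iff_gcd_eq_1[of i "int (ord x0)"] by simp
  then have "gcd (i * j) (int (ord x0)) = 1" using coprime_iff_gcd_eq_1 by blast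
  ultimately have "x [^] j \<in> approx_class G x0"
    using x0G y by (auto simp: approx_class_def approx_rel_def G1_def)
  then show ?thesis using x0(1) X(2) by blast
qed

text \<open>
  Membership in the two families determines the value at \<open>x [^] k\<close> whenever the value at
  \<open>x\<close> is nonzero. The zeros follow because another admissible power map, under which nonzero values
  stay nonzero, takes \<open>x [^] k\<close> back to \<open>x\<close>.
\<close>

lemma connection_power:
  assumes fin: "finite (carrier G)" and S: "S \<subseteq> carrier G"
    and A: "S - antisym_part G S \<in> boolean_algebra_of G" and T: "antisym_part G S \<in> DD G"
    and k: "coprime k (2 * card (carrier G))" and x: "x \<in> carrier G"
  shows "connection S (x [^] k) = connection S x ^ k"
proof -
  have i_case: "connection S (y [^] k) = \<i> ^ k"
    if k: "coprime k (2 * card (carrier G))" and y: "y \<in> antisym_part G S" for k y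
  proof -
    have cop: "coprime (int k) (int (card (carrier G)))" "odd k" "coprime k (card (carrier G))"
      using k by auto
    have y4: "y \<in> carrier G" "ord y mod 4 = 0"
    proof -
      show "y \<in> carrier G" using y S by (auto simp: antisym_part_def)
      have "group_exponent G mod 4 = 0" using T y by (auto simp: DD_def split: if_splits)
      then show "ord y mod 4 = 0"
        using T y by (auto simp: DD_def approx_class_def approx_rel_def Gamma4_def)
    qed
    have "coprime k (ord y)"
      using cop(3) ord_dvd_group_order[OF y4(1)] unfolding Coset.order_def by (metis coprime_divisors dvd_refl)
    then have ord: "ord (y [^] k) = ord y" using pow_ord_eq_ord_iff[OF fin y4(1)] by simp
    have "k mod 4 = 1 \<or> k mod 4 = 3" using cop(2) by presburger
    then show ?thesis
    proof
      assume k1: "k mod 4 = 1"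
      then have "int k mod 4 = 1" by presburger
      then have "y [^] int k \<in> antisym_part G S"
        using cop(1) y4 ord by (intro DD_power_closed[OF T y]) (auto simp: Gamma4_def int_pow_int)
      then show ?thesis using i_power_mod_4(1)[OF k1] by (simp add: int_pow_int connection_eq_i_iff)
    next
      assume k3: "k mod 4 = 3"
      then have "(- int k) mod 4 = 1" by presburger
      then have "y [^] (- int k) \<in> antisym_part G S"
        using cop(1) y4 ord by (intro DD_power_closed[OF T y]) (auto simp: Gamma4_def int_pow_neg_int)
      then have "connection S (inv (y [^] k)) = \<i>"
        using y4(1) by (simp add: int_pow_neg_int connection_eq_i_iff)
      then have "cnj (connection S (y [^] k)) = \<i>" using y4(1) by (simp add: connection_inv)
      then have "connection S (y [^] k) = - \<i>" by (metis complex_cnj_cnj complex_cnj_i)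
      then show ?thesis using i_power_mod_4(2)[OF k3] by simp
    qed
  qed
  have nonzero: "connection S (y [^] k) = connection S y ^ k"
    if k: "coprime k (2 * card (carrier G))" and y: "y \<in> carrier G" "connection S y \<noteq> 0" for k y
  proof -
    consider "connection S y = 1" | "connection S y = \<i>" | "connection S y = -\<i>"
      using connection_values[of S y] y(2) by auto
    then show ?thesis
    proof cases
      case 1
      then have "y [^] k \<in> S - antisym_part G S"
        using boolean_algebra_power_closed[OF A] y(1) k unfolding connection_eq_1_iff by simp
      then have "connection S (y [^] k) = 1" using connection_eq_1_iff by blast
      then show ?thesis using 1 by simp
    next
      case 2
      then show ?thesis using i_case[OF k, of y] by (simp add: connection_eq_i_iff[symmetric])
    next
      case 3
      then have "connection S (inv y) = \<i>" using y(1) by (simp add: connection_inv)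
      then have "connection S ((inv y) [^] k) = \<i> ^ k"
        using i_case[OF k, of "inv y"] by (simp add: connection_eq_i_iff)
      then have "cnj (connection S (y [^] k)) = \<i> ^ k" using y(1) by (simp add: nat_pow_inv connection_inv)
      then have "connection S (y [^] k) = cnj (\<i> ^ k)" by (metis complex_cnj_cnj)
      then show ?thesis using 3 by simp
    qed
  qed
  show ?thesis
  proof (cases "connection S x = 0")
    case True
    obtain k' :: nat where k': "coprime k' (2 * card (carrier G))" "(x [^] k) [^] k' = x"
      using coprime_power_inverse[OF k] x by auto
    have "connection S (x [^] k) = 0"
    proof (rule ccontr)
      assume "connection S (x [^] k) \<noteq> 0"
      then show False using nonzero[OF k'(1), of "x [^] k"] k'(2) x True by simp
    qed
    moreover have "k > 0" using k by (intro Nat.gr0I) simp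
    ultimately show ?thesis using True by simp
  qed (use nonzero k x in blast)
qed

end

theorem theorem4p5:
  fixes G :: "('a, 'b) monoid_scheme" and S :: "'a set"
  assumes "comm_group G" and "finite (carrier G)"
    and "S \<subseteq> carrier G" and "\<one>\<^bsub>G\<^esub> \<notin> S"
  shows "integral_mixed_graph (Cay G S) \<longleftrightarrow>
    S - antisym_part G S \<in> boolean_algebra_of G \<and> antisym_part G S \<in> DD G"
proof -
  interpret comm_group G by fact
  note fin = assms(2) and S = assms(3)
  show ?thesis
  proof
    assume "integral_mixed_graph (Cay G S)"
    then have inv: "connection S (x [^]\<^bsub>G\<^esub> k) = connection S x ^ k"
      if "coprime k (2 * card (carrier G))" "x \<in> carrier G" for k x
      using that integral_Cay_iff[OF fin] by blast
    have "S - antisym_part G S \<in> boolean_algebra_of G"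
    proof (rule power_closed_in_boolean_algebra[OF fin])
      show "S - antisym_part G S \<subseteq> carrier G" using S by auto
      show "2 * card (carrier G) > 0" using fin by (auto simp: card_gt_0_iff)
      fix k x assume k: "coprime k (2 * card (carrier G))" and x: "x \<in> S - antisym_part G S"
      then have "connection S (x [^]\<^bsub>G\<^esub> k) = 1 ^ k"
        using inv[OF k, of x] S connection_eq_1_iff[of S x] by auto
      then show "x [^]\<^bsub>G\<^esub> k \<in> S - antisym_part G S" by (simp add: connection_eq_1_iff)
    qed
    then show "S - antisym_part G S \<in> boolean_algebra_of G \<and> antisym_part G S \<in> DD G"
      using antisym_part_in_DD[OF fin S inv] by blast
  next
    assume "S - antisym_part G S \<in> boolean_algebra_of G \<and> antisym_part G S \<in> DD G"
    then show "integral_mixed_graph (Cay G S)"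
      using integral_Cay_iff[OF fin] connection_power[OF fin S] by blast
  qed
qed

end
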